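(* Let $p$ be an odd prime number and let $g\ge 2$ be an integer such that $g\equiv -1\pmod p$. If $G$ is an extra-special group of order $p^{2g+1}$, then the number $N_g^{\circ}(G)$ of admissible epimorphisms $\varphi\colon\mathsf{B}_2(\Sigma_g)\to G$, up to automorphisms of $G$, is given by $$N_g^{\circ}(G)=\begin{cases}1&\text{if } G=\mathsf{H}_{2g+1}(\mathbb{F}_p),\\ p^{2g}-1&\text{if } G=\mathsf{G}_{2g+1}(\mathbb{F}_p).\end{cases}$$
   Context: Commutators are $[x,y]=xyx^{-1}y^{-1}$. Let $\Sigma_g$ be a compact Riemann surface of genus $g$. The full braid group on two strings $\mathsf{B}_2(\Sigma_g)\simeq\pi_1(\operatorname{Sym}^2\Sigma_g-\delta)$ (with $\delta$ the diagonal) is the group generated by $a_1,b_1,\dots,a_g,b_g,\sigma$ subject to the relations: $[a_i,\sigma^{-1}a_i\sigma^{-1}]=1$ and $[b_i,\sigma^{-1}b_i\sigma^{-1}]=1$ for $1\le i\le g$; $[a_i,\sigma^{-1}a_j\sigma]=[a_i,\sigma^{-1}b_j\sigma]=[b_i,\sigma^{-1}a_j\sigma]=[b_i,\sigma^{-1}b_j\sigma]=1$ for $j<i$; $[a_i,\sigma^{-1}b_i\sigma^{-1}]=\sigma^2$ for $1\le i\le g$; and $[a_1,b_1^{-1}]\cdots[a_g,b_g^{-1}]=\sigma^2$. For a finite group $G$, a group epimorphism $\varphi\colon\mathsf{B}_2(\Sigma_g)\to G$ is called admissible if $\varphi(\sigma)$ has order $n\ge 2$ (i.e. $\varphi(\sigma)\neq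 1$). $N_g^{\circ}(G)$ is the number of orbits of $\operatorname{Aut}(G)$ acting by post-composition on the set of admissible epimorphisms $\mathsf{B}_2(\Sigma_g)\to G$. A finite $p$-group $G$ is extra-special if its center $Z(G)$ is cyclic of order $p$ and $G/Z(G)$ is a nontrivial elementary abelian $p$-group. It is classical that for $g\ge 2$ there are exactly two isomorphism classes of extra-special groups of order $p^{2g+1}$, represented by the groups generated by $x_1,y_1,\dots,x_g,y_g,z$ with the following relations, for all $i,j$. Common relations: $z^p=1$, $[x_i,z]=[y_i,z]=1$, $[x_i,x_j]=[y_i,y_j]=1$, $[x_i,y_j]=z^{-\delta_{ij}}$ ($\delta_{ij}$ the Kronecker symbol). In $\mathsf{H}_{2g+1}(\mathbb{F}_p)$ one adds $x_i^p=y_i^p=1$ for all $i=1,\dots,g$; in $\mathsf{G}_{2g+1}(\mathbb{F}_p)$ one adds $x_i^p=y_i^p=1$ for $i=1,\dots,g-1$ and $x_g^p=y_g^p=z$. *)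

theory Defs
  imports "HOL-Algebra.Algebra" "HOL-Number_Theory.Cong"
begin

section \<open>Group presentations\<close>

text \<open>The letter \<open>(x, True)\<close> stands for the generator \<open>x\<close>, and \<open>(x, False)\<close> for its formal inverse.\<close>

type_synonym 'x word = "('x \<times> bool) list"

definition words :: "'x set \<Rightarrow> 'x word set"
  where "words S = lists (S \<times> UNIV)"

definition gen :: "'x \<Rightarrow> 'x word"
  where "gen x = [(x, True)]"

definition winv :: "'x word \<Rightarrow> 'x word"
  where "winv u = rev (map (\<lambda>(x, e). (x, \<not> e)) u)"

definition wpow :: "nat \<Rightarrow> 'x word \<Rightarrow> 'x word"
  where "wpow n u = concat (replicate n u)"

definition wcomm :: "'x word \<Rightarrow> 'x word \<Rightarrow> 'x word"
  where "wcomm u v = u @ v @ winv u @ winv v"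

text \<open>
  The smallest congruence on the words over \<open>S\<close> that contains free cancellation and the
  relations \<open>R\<close>, where a pair \<open>(u, v)\<close> in \<open>R\<close> represents the relation \<open>u = v\<close>.
\<close>

inductive_set word_cong :: "'x set \<Rightarrow> ('x word \<times> 'x word) set \<Rightarrow> ('x word \<times> 'x word) set"
  for S R where
  wc_refl: "u \<in> words S \<Longrightarrow> (u, u) \<in> word_cong S R"
| wc_sym: "(u, v) \<in> word_cong S R \<Longrightarrow> (v, u) \<in> word_cong S R"
| wc_trans: "(u, v) \<in> word_cong S R \<Longrightarrow> (v, w) \<in> word_cong S R \<Longrightarrow> (u, w) \<in> word_cong S R"
| wc_append: "(u, u') \<in> word_cong S R \<Longrightarrow> (v, v') \<in> word_cong S R
    \<Longrightarrow> (u @ v, u' @ v') \<in> word_cong S R"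
| wc_cancel: "x \<in> S \<Longrightarrow> ([(x, e), (x, \<not> e)], []) \<in> word_cong S R"
| wc_rel: "(u, v) \<in> R \<Longrightarrow> u \<in> words S \<Longrightarrow> v \<in> words S \<Longrightarrow> (u, v) \<in> word_cong S R"

definition word_class :: "'x set \<Rightarrow> ('x word \<times> 'x word) set \<Rightarrow> 'x word \<Rightarrow> 'x word set"
  where "word_class S R u = word_cong S R `` {u}"

definition presented_group :: "'x set \<Rightarrow> ('x word \<times> 'x word) set \<Rightarrow> 'x word set monoid"
  where "presented_group S R =
    \<lparr> carrier = words S // word_cong S R,
      monoid.mult = (\<lambda>U V. word_cong S R `` {u @ v | u v. u \<in> U \<and> v \<in> V}),
      one = word_class S R [] \<rparr>"

lemma words_simps [simp]:
  "[] \<in> words S"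
  "l # u \<in> words S \<longleftrightarrow> fst l \<in> S \<and> u \<in> words S"
  "u @ v \<in> words S \<longleftrightarrow> u \<in> words S \<and> v \<in> words S"
  "winv u \<in> words S \<longleftrightarrow> u \<in> words S"
  by (cases l; force simp: words_def winv_def in_lists_conv_set)+

lemma word_cong_words: "(u, v) \<in> word_cong S R \<Longrightarrow> u \<in> words S \<and> v \<in> words S"
  by (induction rule: word_cong.induct) auto

lemma equiv_word_cong: "equiv (words S) (word_cong S R)"
  by (rule equivI)
     (auto intro!: refl_onI symI transI intro: wc_refl wc_sym wc_trans dest: word_cong_words)

lemma word_cong_winv: "u \<in> words S \<Longrightarrow> (winv u @ u, []) \<in> word_cong S R"
proof (induction u)
  case Nil
  then show ?case by (simp add: winv_def wc_refl)
next
  case (Cons l u)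
  obtain x e where l: "l = (x, e)" by (cases l)
  have w: "x \<in> S" "u \<in> words S" using Cons.prems l by auto
  have "([(x, \<not> e), (x, e)], []) \<in> word_cong S R"
    using wc_cancel[OF w(1), of "\<not> e"] by simp
  then have "(winv u @ [(x, \<not> e), (x, e)] @ u, winv u @ [] @ u) \<in> word_cong S R"
    using w by (intro wc_append wc_refl) simp_all
  also have "winv u @ [(x, \<not> e), (x, e)] @ u = winv (l # u) @ l # u"
    by (simp add: winv_def l)
  finally show ?case
    using Cons.IH[OF w(2)] wc_trans by fastforce
qed

lemma carrier_presented_group: "carrier (presented_group S R) = word_class S R ` words S"
  by (auto simp: presented_group_def word_class_def quotient_def)

lemma one_presented_group: "\<one>\<^bsub>presented_group S R\<^esub> = word_class S R []"
  by (simp add: presented_group_def)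

lemma mult_presented_group:
  assumes "u \<in> words S" "v \<in> words S"
  shows "word_class S R u \<otimes>\<^bsub>presented_group S R\<^esub> word_class S R v = word_class S R (u @ v)"
  using assms
  by (auto simp: presented_group_def word_class_def intro: wc_refl wc_trans wc_append)

lemma word_class_eq_iff:
  "u \<in> words S \<Longrightarrow> v \<in> words S \<Longrightarrow>
    word_class S R u = word_class S R v \<longleftrightarrow> (u, v) \<in> word_cong S R"
  unfolding word_class_def by (rule eq_equiv_class_iff[OF equiv_word_cong])

lemma group_presented_group: "group (presented_group S R)"
proof (rule groupI)
  fix U assume "U \<in> carrier (presented_group S R)"
  then obtain u where u: "u \<in> words S" "U = word_class S R u"
    by (auto simp: carrier_presented_group)
  then have "word_class S R (winv u) \<otimes>\<^bsub>presented_group S R\<^esub> U = word_class S R []"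
    by (simp add: mult_presented_group word_class_eq_iff word_cong_winv)
  then show "\<exists>V\<in>carrier (presented_group S R). V \<otimes>\<^bsub>presented_group S R\<^esub> U = \<one>\<^bsub>presented_group S R\<^esub>"
    using u by (auto simp: carrier_presented_group one_presented_group)
next
  show "\<one>\<^bsub>presented_group S R\<^esub> \<in> carrier (presented_group S R)"
    by (auto simp: one_presented_group carrier_presented_group)
  show "\<one>\<^bsub>presented_group S R\<^esub> \<otimes>\<^bsub>presented_group S R\<^esub> U = U"
    if "U \<in> carrier (presented_group S R)" for U
    using that by (auto simp: one_presented_group carrier_presented_group mult_presented_group)
qed (auto simp: carrier_presented_group mult_presented_group)


section \<open>The braid group on two strings of a surface\<close>

datatype braid_gen = BrA nat | BrB nat | BrSigma

definition braid_gens :: "nat \<Rightarrow> braid_gen set"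
  where "braid_gens g = BrA ` {1..g} \<union> BrB ` {1..g} \<union> {BrSigma}"

definition braid_rels :: "nat \<Rightarrow> (braid_gen word \<times> braid_gen word) set"
  where "braid_rels g =
    (let a = (\<lambda>i. gen (BrA i)); b = (\<lambda>i. gen (BrB i)); s = gen BrSigma; s' = winv s in
      {(wcomm (a i) (s' @ a i @ s'), []) | i. i \<in> {1..g}} \<union>
      {(wcomm (b i) (s' @ b i @ s'), []) | i. i \<in> {1..g}} \<union>
      {(wcomm (a i) (s' @ a j @ s), []) | i j. i \<in> {1..g} \<and> j \<in> {1..g} \<and> j < i} \<union>
      {(wcomm (a i) (s' @ b j @ s), []) | i j. i \<in> {1..g} \<and> j \<in> {1..g} \<and> j < i} \<union>
      {(wcomm (b i) (s' @ a j @ s), []) | i j. i \<in> {1..g} \<and> j \<in> {1..g} \<and> j < i} \<union>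
      {(wcomm (b i) (s' @ b j @ s), []) | i j. i \<in> {1..g} \<and> j \<in> {1..g} \<and> j < i} \<union>
      {(wcomm (a i) (s' @ b i @ s'), wpow 2 s) | i. i \<in> {1..g}} \<union>
      {(concat (map (\<lambda>i. wcomm (a i) (winv (b i))) [1..<Suc g]), wpow 2 s)})"

definition B2 :: "nat \<Rightarrow> braid_gen word set monoid"
  where "B2 g = presented_group (braid_gens g) (braid_rels g)"

definition sigma :: "nat \<Rightarrow> braid_gen word set"
  where "sigma g = word_class (braid_gens g) (braid_rels g) (gen BrSigma)"


section \<open>Admissible epimorphisms up to automorphisms\<close>

text \<open>
  Homomorphisms of HOL-Algebra are arbitrary outside the carrier of their domain. Restricting to
  extensional functions gives one function for each epimorphism, so that counting makes sense.
\<close>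

definition admissible_epis ::
    "nat \<Rightarrow> ('a, 'b) monoid_scheme \<Rightarrow> (braid_gen word set \<Rightarrow> 'a) set"
  where "admissible_epis g G =
    {\<phi> \<in> epi (B2 g) G. \<phi> \<in> extensional (carrier (B2 g)) \<and> group.ord G (\<phi> (sigma g)) \<ge> 2}"

definition N_circ :: "nat \<Rightarrow> ('a, 'b) monoid_scheme \<Rightarrow> nat"
  where "N_circ g G =
    card (orbits (AutoGroup G) (admissible_epis g G) (\<lambda>\<alpha> \<phi>. compose (carrier (B2 g)) \<alpha> \<phi>))"


section \<open>Extra-special groups\<close>

definition center :: "('a, 'b) monoid_scheme \<Rightarrow> 'a set"
  where "center G = {z \<in> carrier G. \<forall>x \<in> carrier G. z \<otimes>\<^bsub>G\<^esub> x = x \<otimes>\<^bsub>G\<^esub> z}"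

definition elementary_abelian :: "nat \<Rightarrow> ('a, 'b) monoid_scheme \<Rightarrow> bool"
  where "elementary_abelian p A \<longleftrightarrow>
    comm_group A \<and> (\<forall>x \<in> carrier A. x [^]\<^bsub>A\<^esub> p = \<one>\<^bsub>A\<^esub>)"

definition extra_special :: "nat \<Rightarrow> ('a, 'b) monoid_scheme \<Rightarrow> bool"
  where "extra_special p G \<longleftrightarrow>
    group G \<and> finite (carrier G) \<and> (\<exists>n. order G = p ^ n) \<and>
    cyclic_group (G\<lparr>carrier := center G\<rparr>) \<and> card (center G) = p \<and>
    elementary_abelian p (G Mod center G) \<and> \<not> trivial_group (G Mod center G)"

datatype es_gen = EsX nat | EsY nat | EsZ

definition es_gens :: "nat \<Rightarrow> es_gen set"
  where "es_gens g = EsX ` {1..g} \<union> EsY ` {1..g} \<union> {EsZ}"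

definition es_common_rels :: "nat \<Rightarrow> nat \<Rightarrow> (es_gen word \<times> es_gen word) set"
  where "es_common_rels p g =
    (let x = (\<lambda>i. gen (EsX i)); y = (\<lambda>i. gen (EsY i)); z = gen EsZ in
      {(wpow p z, [])} \<union>
      {(wcomm (x i) z, []) | i. i \<in> {1..g}} \<union>
      {(wcomm (y i) z, []) | i. i \<in> {1..g}} \<union>
      {(wcomm (x i) (x j), []) | i j. i \<in> {1..g} \<and> j \<in> {1..g}} \<union>
      {(wcomm (y i) (y j), []) | i j. i \<in> {1..g} \<and> j \<in> {1..g}} \<union>
      {(wcomm (x i) (y j), if i = j then winv z else []) | i j. i \<in> {1..g} \<and> j \<in> {1..g}})"

definition H_group :: "nat \<Rightarrow> nat \<Rightarrow> es_gen word set monoid"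
  where "H_group p g = presented_group (es_gens g)
    (es_common_rels p g \<union>
      {(wpow p (gen (EsX i)), []) | i. i \<in> {1..g}} \<union>
      {(wpow p (gen (EsY i)), []) | i. i \<in> {1..g}})"

definition G_group :: "nat \<Rightarrow> nat \<Rightarrow> es_gen word set monoid"
  where "G_group p g = presented_group (es_gens g)
    (es_common_rels p g \<union>
      {(wpow p (gen (EsX i)), []) | i. i \<in> {1..<g}} \<union>
      {(wpow p (gen (EsY i)), []) | i. i \<in> {1..<g}} \<union>
      {(wpow p (gen (EsX g)), gen EsZ), (wpow p (gen (EsY g)), gen EsZ)})"

end

theory Submission
  imports Defs
begin

text \<open>
  Let \<open>G\<close> be extra-special of order \<open>p ^ (2 * g + 1)\<close> with centre \<open>Z\<close>, and let \<open>\<phi>\<close> be an admissible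
  epimorphism with \<open>s = \<phi> \<sigma>\<close>. Commutators in \<open>G\<close> lie in \<open>Z\<close>, so the relation
  \<open>[a\<^sub>i, \<sigma>\<^sup>-\<^sup>1 b\<^sub>i \<sigma>\<^sup>-\<^sup>1] = \<sigma>\<^sup>2\<close> puts \<open>s\<^sup>2\<close>, and then \<open>s\<close> itself because \<open>p\<close> is odd, into \<open>Z\<close>. Once \<open>s\<close> is
  central, conjugation by \<open>\<sigma>\<close> disappears from the relations. They say that the images of
  \<open>a\<^sub>1, \<dots>, a\<^sub>g, b\<^sub>1, \<dots>, b\<^sub>g\<close> commute except for \<open>[a\<^sub>i, b\<^sub>i] = w\<close>, where \<open>w = s\<^sup>2\<close>, and that
  \<open>w\<^sup>-\<^sup>g = w\<close>, which is the hypothesis \<open>g \<equiv> -1\<close> modulo \<open>p\<close>. Hence an admissible epimorphism is the same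
  as a symplectic frame: a nontrivial central \<open>w\<close> with a tuple \<open>t\<close> that lifts a symplectic
  basis of \<open>G / Z\<close> for the commutator form with values in the powers of \<open>w\<close>
  (\<open>admissible_epi_frame\<close>, \<open>frame_admissible_epi\<close>). Surjectivity comes for free, because the
  ordered products of powers of \<open>w\<close> and the \<open>t\<^sub>i\<close> with exponents below \<open>p\<close> are pairwise distinct and
  there are \<open>p ^ (2 * g + 1)\<close> of them.

  The only invariant of a frame under automorphisms is its vector of \<open>p\<close>-th powers, the numbers
  \<open>c\<^sub>i\<close> modulo \<open>p\<close> with \<open>t\<^sub>i\<^sup>p = w\<close> to the power \<open>c\<^sub>i\<close>. Indeed, multiplication of the products above and
  the condition for such a product to be trivial depend on \<open>c\<close> alone, so two frames with the same
  \<open>c\<close> correspond under an automorphism (\<open>exists_automorphism\<close>). Therefore \<open>N_circ g G\<close> is the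
  number of vectors \<open>c\<close> that occur (\<open>N_circ_eq_card_power_vectors\<close>).

  In both groups the generators of the presentation provide one frame (\<open>presentation_frame\<close>). The
  \<open>p\<close>-th power map is a homomorphism from \<open>G\<close> to \<open>Z\<close>, as \<open>p\<close> is odd. If it is trivial, as in \<open>H_group\<close>, then
  only \<open>c = 0\<close> occurs and the count is 1. If it is not trivial, as in \<open>G_group\<close>, then \<open>c = 0\<close> cannot
  occur since the frame generates \<open>G\<close>, while every other vector does: changing the frame by a symplectic
  transvection moves \<open>c\<close> to any \<open>d\<close> whose symplectic pairing with \<open>c\<close> is nonzero, and any two nonzero
  vectors are joined by two such moves (\<open>transvection\<close>, \<open>pairing_connect\<close>). This leaves
  \<open>p ^ (2 * g) - 1\<close> vectors.
\<close>


section \<open>Commutators that are powers of a central element of prime order\<close>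

lemma (in group) commute_inv:
  assumes "x \<otimes> y = y \<otimes> x" and [simp]: "x \<in> carrier G" "y \<in> carrier G"
  shows "inv x \<otimes> y = y \<otimes> inv x"
proof -
  have "inv x \<otimes> y = inv x \<otimes> (y \<otimes> x) \<otimes> inv x" by (simp add: m_assoc)
  also have "\<dots> = y \<otimes> inv x" unfolding assms(1)[symmetric] by (simp flip: m_assoc)
  finally show ?thesis .
qed

locale central_prime_element = group G for G (structure) +
  fixes w :: 'a and p :: nat
  assumes w_closed [simp]: "w \<in> carrier G"
    and w_central: "x \<in> carrier G \<Longrightarrow> w \<otimes> x = x \<otimes> w"
    and prime_p: "Factorial_Ring.prime p"
    and w_pow_p: "w [^] p = \<one>"
    and w_neq_one: "w \<noteq> \<one>"
begin

lemma ord_w: "ord w = p"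
proof -
  have "ord w dvd p" using w_pow_p pow_eq_id[OF w_closed] by blast
  moreover have "ord w \<noteq> 1" using ord_eq_1[OF w_closed] w_neq_one by simp
  ultimately show ?thesis using prime_p by (auto simp: prime_nat_iff)
qed

lemma w_pow_eq_iff: "w [^] (k :: int) = w [^] (l :: int) \<longleftrightarrow> [k = l] (mod int p)"
  by (simp add: int_pow_eq ord_w cong_iff_dvd_diff dvd_diff_commute)

lemma w_pow_eq_one_iff: "w [^] (k :: int) = \<one> \<longleftrightarrow> int p dvd k"
  by (simp add: int_pow_eq_id ord_w)

lemma w_pow_central:
  assumes "x \<in> carrier G"
  shows "x \<otimes> w [^] (k :: int) = w [^] k \<otimes> x"
proof (induction k rule: int_induct[of _ 0])
  case base
  then show ?case using assms by simp
next
  case (step1 i)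
  have "x \<otimes> w [^] (i + 1) = (x \<otimes> w [^] i) \<otimes> w"
    using assms by (simp add: int_pow_mult m_assoc)
  also have "\<dots> = w [^] i \<otimes> (w \<otimes> x)"
    using assms by (simp add: step1.IH m_assoc w_central)
  finally show ?case using assms by (simp add: int_pow_mult m_assoc)
next
  case (step2 i)
  have inv: "x \<otimes> inv w = inv w \<otimes> x"
    using assms by (simp add: commute_inv w_central)
  have "x \<otimes> w [^] (i - 1) = (x \<otimes> w [^] i) \<otimes> inv w"
    using assms by (simp add: int_pow_diff m_assoc)
  also have "\<dots> = w [^] i \<otimes> (inv w \<otimes> x)"
    using assms by (simp add: step2.IH m_assoc inv)
  finally show ?case using assms by (simp add: int_pow_diff m_assoc)
qed

lemma w_pow_left:
  assumes "x \<in> carrier G" "y \<in> carrier G"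
  shows "x \<otimes> (w [^] (k :: int) \<otimes> y) = w [^] k \<otimes> (x \<otimes> y)"
  using assms by (metis m_assoc int_pow_closed w_closed w_pow_central)

lemma w_pow_merge:
  assumes "x \<in> carrier G"
  shows "w [^] (k :: int) \<otimes> (w [^] (l :: int) \<otimes> x) = w [^] (k + l) \<otimes> x"
  using assms by (simp add: int_pow_mult m_assoc)

text \<open>
  The commutator of \<open>x\<close> and \<open>y\<close> is \<open>w [^] k\<close>, written without inverses; the exponent \<open>k\<close> is only
  determined modulo \<open>p\<close>. In terms of exponents the bilinearity of the commutator, which holds because
  \<open>w\<close> is central, becomes arithmetic in the integers.
\<close>

definition comm_exp :: "'a \<Rightarrow> 'a \<Rightarrow> int \<Rightarrow> bool"
  where "comm_exp x y k \<longleftrightarrow> x \<otimes> y = w [^] k \<otimes> (y \<otimes> x)"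

lemma comm_exp_sym:
  assumes "comm_exp x y k" "x \<in> carrier G" "y \<in> carrier G"
  shows "comm_exp y x (- k)"
  using assms by (simp add: comm_exp_def w_pow_merge)

lemma comm_exp_unique:
  assumes "comm_exp x y k" "comm_exp x y l" "x \<in> carrier G" "y \<in> carrier G"
  shows "[k = l] (mod int p)"
proof -
  have "w [^] k \<otimes> (y \<otimes> x) = w [^] l \<otimes> (y \<otimes> x)"
    using assms by (simp add: comm_exp_def)
  then show ?thesis using assms by (simp add: w_pow_eq_iff)
qed

lemma comm_exp_w_left: "y \<in> carrier G \<Longrightarrow> comm_exp (w [^] (k :: int)) y 0"
  by (simp add: comm_exp_def w_pow_central)

lemma comm_exp_mult_left:
  assumes "comm_exp x y k" "comm_exp x' y l"
    and [simp]: "x \<in> carrier G" "x' \<in> carrier G" "y \<in> carrier G"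
  shows "comm_exp (x \<otimes> x') y (k + l)"
proof -
  have "x \<otimes> x' \<otimes> y = x \<otimes> (w [^] l \<otimes> (y \<otimes> x'))"
    using assms(2) by (simp add: m_assoc comm_exp_def)
  also have "\<dots> = w [^] l \<otimes> (x \<otimes> y \<otimes> x')"
    by (simp add: w_pow_left m_assoc)
  also have "\<dots> = w [^] (l + k) \<otimes> (y \<otimes> (x \<otimes> x'))"
    using assms(1) by (simp add: comm_exp_def m_assoc w_pow_merge)
  finally show ?thesis by (simp add: comm_exp_def add.commute)
qed

lemma comm_exp_inv_left:
  assumes "comm_exp x y k" and [simp]: "x \<in> carrier G" "y \<in> carrier G"
  shows "comm_exp (inv x) y (- k)"
proof -
  have "x \<otimes> (inv x \<otimes> y) = x \<otimes> (w [^] (- k) \<otimes> (y \<otimes> inv x))"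
  proof -
    have "x \<otimes> (w [^] (- k) \<otimes> (y \<otimes> inv x)) = w [^] (- k) \<otimes> (x \<otimes> y \<otimes> inv x)"
      by (simp add: w_pow_left m_assoc)
    also have "\<dots> = y"
      using assms(1) by (simp add: comm_exp_def m_assoc w_pow_merge)
    finally show ?thesis by (simp flip: m_assoc)
  qed
  then show ?thesis by (simp only: comm_exp_def l_cancel m_closed inv_closed int_pow_closed w_closed assms(2,3))
qed

lemma comm_exp_pow_left:
  assumes "comm_exp x y k" and [simp]: "x \<in> carrier G" "y \<in> carrier G"
  shows "comm_exp (x [^] (n :: int)) y (n * k)"
proof (induction n rule: int_induct[of _ 0])
  case base
  then show ?case by (simp add: comm_exp_def)
next
  case (step1 i)
  then have "comm_exp (x [^] i \<otimes> x) y (i * k + k)"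
    using assms by (intro comm_exp_mult_left) simp_all
  then show ?case by (simp add: int_pow_mult distrib_right)
next
  case (step2 i)
  then have "comm_exp (x [^] i \<otimes> inv x) y (i * k + - k)"
    using assms by (intro comm_exp_mult_left comm_exp_inv_left) simp_all
  then show ?case by (simp add: int_pow_diff left_diff_distrib)
qed

lemma comm_exp_mult_right:
  assumes "comm_exp x y k" "comm_exp x y' l"
    and [simp]: "x \<in> carrier G" "y \<in> carrier G" "y' \<in> carrier G"
  shows "comm_exp x (y \<otimes> y') (k + l)"
  using comm_exp_sym[OF comm_exp_mult_left[OF assms(1,2)[THEN comm_exp_sym]]]
  by (simp add: add.commute)

lemma comm_exp_pow_right:
  assumes "comm_exp x y k" and [simp]: "x \<in> carrier G" "y \<in> carrier G"
  shows "comm_exp x (y [^] (n :: int)) (n * k)"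
  using comm_exp_sym[OF comm_exp_pow_left[OF assms(1)[THEN comm_exp_sym]]] by simp

text \<open>
  Sorting \<open>x y x y \<dots> x y\<close> into \<open>x\<^sup>n y\<^sup>n\<close> moves a \<open>y\<close> past an \<open>x\<close> exactly \<open>n (n - 1) / 2\<close> times, and each
  move contributes one factor \<open>w [^] k\<close>.
\<close>

lemma pow_mult_comm_exp:
  assumes "comm_exp y x k" and [simp]: "x \<in> carrier G" "y \<in> carrier G"
  shows "(x \<otimes> y) [^] n = w [^] (k * int (n * (n - 1) div 2)) \<otimes> (x [^] n \<otimes> y [^] n)"
proof (induction n)
  case 0
  then show ?case by simp
next
  case (Suc n)
  define q where "q = n * (n - 1) div 2"
  have q: "Suc n * (Suc n - 1) div 2 = q + n"
  proof -
    have "even (n * (n - 1))" by (cases n) auto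
    then have "n * (n - 1) = 2 * q" by (simp add: q_def)
    then have "Suc n * (Suc n - 1) = 2 * (q + n)" by (cases n) (auto simp: algebra_simps)
    then show ?thesis by simp
  qed
  have sw: "y [^] n \<otimes> x = w [^] (int n * k) \<otimes> (x \<otimes> y [^] n)"
    using comm_exp_pow_left[OF assms(1), of "int n"] by (simp add: comm_exp_def int_pow_int)
  have "(x \<otimes> y) [^] Suc n = w [^] (k * int q) \<otimes> (x [^] n \<otimes> (y [^] n \<otimes> x) \<otimes> y)"
    by (simp add: Suc.IH q_def m_assoc)
  also have "\<dots> = w [^] (k * int q) \<otimes> (w [^] (int n * k) \<otimes> (x [^] Suc n \<otimes> y [^] Suc n))"
    unfolding sw by (simp add: w_pow_left[of "x [^] n"] m_assoc)
  also have "\<dots> = w [^] (k * int (q + n)) \<otimes> (x [^] Suc n \<otimes> y [^] Suc n)"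
    by (simp add: w_pow_merge algebra_simps)
  finally show ?case unfolding q .
qed

text \<open>
  For odd \<open>p\<close> the number \<open>p (p - 1) / 2\<close> of exchanges is a multiple of \<open>p\<close>, the order of \<open>w\<close>.
\<close>

lemma pow_p_mult:
  assumes "comm_exp y x k" "odd p" and [simp]: "x \<in> carrier G" "y \<in> carrier G"
  shows "(x \<otimes> y) [^] p = x [^] p \<otimes> y [^] p"
proof -
  have "even (p - 1)" using assms(2) by simp
  then have "p * (p - 1) div 2 = p * ((p - 1) div 2)" by (metis div_mult_swap)
  then have "int p dvd k * int (p * (p - 1) div 2)" by simp
  then have "w [^] (k * int (p * (p - 1) div 2)) = \<one>" by (simp only: w_pow_eq_one_iff)
  then show ?thesis by (simp add: pow_mult_comm_exp[OF assms(1)])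
qed

end


section \<open>Normal forms with respect to a symplectic frame\<close>

primrec (in group) ordered_prod :: "(nat \<Rightarrow> 'a) \<Rightarrow> (nat \<Rightarrow> int) \<Rightarrow> nat \<Rightarrow> 'a"
  where
    "ordered_prod t e 0 = \<one>"
  | "ordered_prod t e (Suc n) = ordered_prod t e n \<otimes> t n [^] e n"

text \<open>
  The exponent of \<open>w\<close> that is collected when a product of two ordered products is sorted. It
  depends on the commutator exponents \<open>J\<close> but not on the elements themselves, which is what allows two
  frames to be compared.
\<close>

primrec twist :: "(nat \<Rightarrow> nat \<Rightarrow> int) \<Rightarrow> (nat \<Rightarrow> int) \<Rightarrow> (nat \<Rightarrow> int) \<Rightarrow> nat \<Rightarrow> int"
  where
    "twist J e e' 0 = 0"
  | "twist J e e' (Suc n) = twist J e e' n - e n * (\<Sum>j<n. e' j * J j n)"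

lemma (in group) ordered_prod_closed:
  "(\<And>i. i < n \<Longrightarrow> t i \<in> carrier G) \<Longrightarrow> ordered_prod t e n \<in> carrier G"
  by (induction n) auto

lemma (in group) ordered_prod_unit:
  assumes "\<And>i. i < n \<Longrightarrow> t i \<in> carrier G"
  shows "ordered_prod t (\<lambda>i. if i = j then 1 else 0) n = (if j < n then t j else \<one>)"
  using assms
proof (induction n)
  case 0
  then show ?case by simp
next
  case (Suc n)
  have "j < Suc n \<longleftrightarrow> j = n \<or> j < n" by auto
  with Suc show ?case by auto
qed

context central_prime_element
begin

lemma comm_exp_ordered_prod:
  assumes "\<And>i. i < n \<Longrightarrow> t i \<in> carrier G" "y \<in> carrier G"
    and "\<And>i. i < n \<Longrightarrow> comm_exp (t i) y (m i)"
  shows "comm_exp (ordered_prod t e n) y (\<Sum>i<n. e i * m i)"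
  using assms
proof (induction n)
  case 0
  then show ?case by (simp add: comm_exp_def)
next
  case (Suc n)
  then have "comm_exp (ordered_prod t e n \<otimes> t n [^] e n) y ((\<Sum>i<n. e i * m i) + e n * m n)"
    by (intro comm_exp_mult_left comm_exp_pow_left ordered_prod_closed) auto
  then show ?case by simp
qed

lemma ordered_prod_mult:
  assumes "\<And>i. i < n \<Longrightarrow> t i \<in> carrier G"
    and "\<And>i j. i < n \<Longrightarrow> j < n \<Longrightarrow> comm_exp (t i) (t j) (J i j)"
  shows "ordered_prod t e n \<otimes> ordered_prod t e' n
    = w [^] twist J e e' n \<otimes> ordered_prod t (\<lambda>i. e i + e' i) n"
  using assms
proof (induction n)
  case 0
  then show ?case by simp
next
  case (Suc n)
  define P where "P e = ordered_prod t e n" for e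
  define x where "x = t n"
  have [simp]: "P e \<in> carrier G" for e
    using Suc.prems by (auto simp: P_def intro!: ordered_prod_closed)
  have [simp]: "x \<in> carrier G" using Suc.prems by (simp add: x_def)
  have IH: "P e \<otimes> P e' = w [^] twist J e e' n \<otimes> P (\<lambda>i. e i + e' i)"
    unfolding P_def using Suc.prems by (intro Suc.IH) auto
  define r where "r = (\<Sum>j<n. e' j * J j n)"
  have "comm_exp (P e') x r"
    unfolding P_def x_def r_def using Suc.prems by (intro comm_exp_ordered_prod) auto
  then have "comm_exp (x [^] e n) (P e') (- (e n * r))"
    by (intro comm_exp_sym comm_exp_pow_right) simp_all
  then have sw: "x [^] e n \<otimes> P e' = w [^] (- (e n * r)) \<otimes> (P e' \<otimes> x [^] e n)"
    by (simp add: comm_exp_def)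
  have "P e \<otimes> x [^] e n \<otimes> (P e' \<otimes> x [^] e' n) = P e \<otimes> (x [^] e n \<otimes> P e') \<otimes> x [^] e' n"
    by (simp add: m_assoc)
  also have "\<dots> = w [^] (- (e n * r)) \<otimes> ((P e \<otimes> P e') \<otimes> (x [^] e n \<otimes> x [^] e' n))"
    unfolding sw by (simp add: w_pow_left[of "P e"] m_assoc)
  also have "\<dots> = w [^] (- (e n * r) + twist J e e' n) \<otimes>
      (P (\<lambda>i. e i + e' i) \<otimes> x [^] (e n + e' n))"
    unfolding IH by (simp add: w_pow_merge m_assoc int_pow_mult)
  finally show ?case
    by (simp add: P_def x_def r_def algebra_simps)
qed

text \<open>
  When all exponents are multiples of \<open>p\<close>, every factor is a power of some \<open>t i [^] p\<close> and hence of \<open>w\<close>.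
\<close>

lemma ordered_prod_dvd:
  assumes "\<And>i. i < n \<Longrightarrow> t i \<in> carrier G"
    and "\<And>i. i < n \<Longrightarrow> t i [^] p = w [^] (c i :: int)"
    and "\<And>i. i < n \<Longrightarrow> int p dvd e i"
  shows "ordered_prod t e n = w [^] (\<Sum>i<n. c i * (e i div int p))"
  using assms
proof (induction n)
  case 0
  then show ?case by simp
next
  case (Suc n)
  have "t n [^] e n = t n [^] (int p * (e n div int p))"
    using Suc.prems(3) by simp
  also have "\<dots> = (t n [^] p) [^] (e n div int p)"
    using Suc.prems(1) by (simp add: int_pow_pow flip: int_pow_int)
  also have "\<dots> = w [^] (c n * (e n div int p))"
    using Suc.prems(2) by (simp add: int_pow_pow)
  finally show ?case using Suc by (simp add: int_pow_mult)
qed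

lemma ordered_prod_pow_p:
  assumes "odd p" and "\<And>i. i < n \<Longrightarrow> t i \<in> carrier G"
    and "\<And>i j. i < n \<Longrightarrow> j < n \<Longrightarrow> comm_exp (t i) (t j) (J i j)"
    and "\<And>i. i < n \<Longrightarrow> t i [^] p = w [^] (c i :: int)"
  shows "ordered_prod t e n [^] p = w [^] (\<Sum>i<n. c i * e i)"
  using assms(2-)
proof (induction n)
  case 0
  then show ?case by simp
next
  case (Suc n)
  have closed: "ordered_prod t e n \<in> carrier G" "t n \<in> carrier G"
    using Suc.prems by (auto intro: ordered_prod_closed)
  have "comm_exp (ordered_prod t e n) (t n [^] e n) (e n * (\<Sum>i<n. e i * J i n))"
    using Suc.prems closed by (intro comm_exp_pow_right comm_exp_ordered_prod) auto
  then have "ordered_prod t e (Suc n) [^] p = ordered_prod t e n [^] p \<otimes> (t n [^] e n) [^] p"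
    using \<open>odd p\<close> closed by (auto intro!: pow_p_mult dest: comm_exp_sym)
  also have "(t n [^] e n) [^] p = (t n [^] p) [^] e n"
    using closed by (simp add: int_pow_pow mult.commute flip: int_pow_int)
  also have "\<dots> = w [^] (c n * e n)"
    using Suc.prems(3) by (simp add: int_pow_pow)
  finally show ?case using Suc by (simp add: int_pow_mult)
qed

end

text \<open>
  The Gram matrix of the standard symplectic form in a basis where the \<open>i\<close>-th vector is dual to the
  \<open>(i + g)\<close>-th.
\<close>

definition symp :: "nat \<Rightarrow> nat \<Rightarrow> nat \<Rightarrow> int"
  where "symp g i j = (if j = i + g then 1 else if i = j + g then - 1 else 0)"

lemma sum_symp:
  assumes "j < 2 * g"
  shows "(\<Sum>i<2 * g. e i * symp g i j) = (if j < g then - e (j + g) else e (j - g))"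
proof -
  have "(\<Sum>i<2 * g. e i * symp g i j)
      = (\<Sum>i<2 * g. if i = (if j < g then j + g else j - g)
          then (if j < g then - e (j + g) else e (j - g)) else 0)"
    using assms by (intro sum.cong) (auto simp: symp_def)
  then show ?thesis using assms by (auto simp: sum.delta)
qed

text \<open>
  The images of the \<open>t i\<close> in \<open>G / \<langle>w\<rangle>\<close> form a symplectic basis for the commutator form, and
  the vector \<open>c\<close> records the \<open>p\<close>-th power map on this basis. It is an integer vector of which only the
  residues modulo \<open>p\<close> matter.
\<close>

locale symplectic_frame = central_prime_element G w p for G (structure) and w p +
  fixes g :: nat and t :: "nat \<Rightarrow> 'a" and c :: "nat \<Rightarrow> int"
  assumes t_closed: "i < 2 * g \<Longrightarrow> t i \<in> carrier G"
    and t_comm_exp: "i < 2 * g \<Longrightarrow> j < 2 * g \<Longrightarrow> comm_exp (t i) (t j) (symp g i j)"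
    and t_pow_p: "i < 2 * g \<Longrightarrow> t i [^] p = w [^] c i"
    and order_G: "order G = p ^ (2 * g + 1)"
begin

definition normal_form :: "int \<Rightarrow> (nat \<Rightarrow> int) \<Rightarrow> 'a"
  where "normal_form k e = w [^] k \<otimes> ordered_prod t e (2 * g)"

lemma ordered_prod_t_closed [simp]: "ordered_prod t e (2 * g) \<in> carrier G"
  by (intro ordered_prod_closed t_closed)

lemma normal_form_closed [simp]: "normal_form k e \<in> carrier G"
  by (simp add: normal_form_def)

lemma comm_exp_normal_form:
  assumes "j < 2 * g"
  shows "comm_exp (normal_form k e) (t j) (if j < g then - e (j + g) else e (j - g))"
proof -
  have "comm_exp (normal_form k e) (t j) (0 + (\<Sum>i<2 * g. e i * symp g i j))"
    unfolding normal_form_def using assms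
    by (intro comm_exp_mult_left comm_exp_w_left comm_exp_ordered_prod t_comm_exp t_closed) simp_all
  then show ?thesis using assms by (simp add: sum_symp)
qed

lemma normal_form_mult:
  "normal_form k e \<otimes> normal_form l e'
    = normal_form (k + l + twist (symp g) e e' (2 * g)) (\<lambda>i. e i + e' i)"
proof -
  have "normal_form k e \<otimes> normal_form l e'
      = w [^] k \<otimes> (w [^] l \<otimes> (ordered_prod t e (2 * g) \<otimes> ordered_prod t e' (2 * g)))"
    by (simp add: normal_form_def m_assoc w_pow_left[of "ordered_prod t e (2 * g)"])
  also have "ordered_prod t e (2 * g) \<otimes> ordered_prod t e' (2 * g)
      = w [^] twist (symp g) e e' (2 * g) \<otimes> ordered_prod t (\<lambda>i. e i + e' i) (2 * g)"
    by (intro ordered_prod_mult t_comm_exp t_closed)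
  finally show ?thesis by (simp add: normal_form_def w_pow_merge add.assoc)
qed

lemma normal_form_zero: "normal_form k (\<lambda>i. 0) = w [^] k"
proof -
  have "ordered_prod t (\<lambda>i. 0) n = \<one>" if "n \<le> 2 * g" for n
    using that by (induction n) auto
  then show ?thesis by (simp add: normal_form_def)
qed

lemma normal_form_unit: "j < 2 * g \<Longrightarrow> normal_form 0 (\<lambda>i. if i = j then 1 else 0) = t j"
  by (simp add: normal_form_def ordered_prod_unit t_closed)

text \<open>
  If the product is trivial, its commutator with the dual of \<open>t i\<close> is trivial as well, which forces
  \<open>p\<close> to divide \<open>e i\<close>. What remains then is a power of \<open>w\<close>. The criterion mentions \<open>c\<close> but
  neither \<open>w\<close> nor \<open>t\<close>.
\<close>

lemma normal_form_eq_one_iff: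
  "normal_form k e = \<one> \<longleftrightarrow>
    (\<forall>i<2 * g. int p dvd e i) \<and> int p dvd k + (\<Sum>i<2 * g. c i * (e i div int p))"
proof -
  have dvd: "int p dvd e i" if one: "normal_form k e = \<one>" and i: "i < 2 * g" for i
  proof -
    \<comment> \<open>The index dual to i: the commutator with t j isolates the exponent e i.\<close>
    define j where "j = (if i < g then i + g else i - g)"
    have j: "j < 2 * g" using i by (auto simp: j_def)
    have "comm_exp \<one> (t j) 0" using j by (simp add: comm_exp_def t_closed)
    then have "[(if j < g then - e (j + g) else e (j - g)) = 0] (mod int p)"
      using comm_exp_normal_form[OF j, of k e] one comm_exp_unique j t_closed by (metis one_closed)
    then show ?thesis using i by (auto simp: j_def cong_0_iff split: if_splits)
  qed
  have "normal_form k e = w [^] (k + (\<Sum>i<2 * g. c i * (e i div int p)))"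
    if "\<forall>i<2 * g. int p dvd e i"
    using that by (simp add: normal_form_def int_pow_mult ordered_prod_dvd[where c = c] t_closed t_pow_p)
  with dvd show ?thesis by (metis w_pow_eq_one_iff)
qed

text \<open>
  The right-hand side is the quotient of the two normal forms, brought into normal form. This reduces
  equality of normal forms to the triviality criterion, again without reference to \<open>w\<close> and \<open>t\<close>.
\<close>

lemma normal_form_eq_iff:
  "normal_form k e = normal_form l e' \<longleftrightarrow>
    normal_form (k - l - twist (symp g) e' (\<lambda>i. - e' i) (2 * g)
      + twist (symp g) e (\<lambda>i. - e' i) (2 * g)) (\<lambda>i. e i - e' i) = \<one>"
proof -
  define l' where "l' = - l - twist (symp g) e' (\<lambda>i. - e' i) (2 * g)"
  have "normal_form l e' \<otimes> normal_form l' (\<lambda>i. - e' i) = normal_form 0 (\<lambda>i. 0)"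
    by (simp add: normal_form_mult l'_def)
  then have inv: "inv (normal_form l e') = normal_form l' (\<lambda>i. - e' i)"
    by (simp add: normal_form_zero inv_equality inv_comm)
  have "normal_form k e = normal_form l e' \<longleftrightarrow> normal_form k e \<otimes> inv (normal_form l e') = \<one>"
    by (metis inv_equality inv_inv normal_form_closed inv_closed r_inv)
  then show ?thesis by (simp add: inv normal_form_mult l'_def algebra_simps)
qed

lemma finite_carrier: "finite (carrier G)"
  using order_G prime_p by (metis order_gt_0_iff_finite prime_gt_0_nat zero_less_power)

text \<open>
  Normal forms with exponents below \<open>p\<close> are pairwise distinct, and their number is the order of \<open>G\<close>.
\<close>

lemma normal_form_surj:
  assumes "x \<in> carrier G"
  obtains k e where "x = normal_form k e"
proof -
  define B where "B = {0..<int p} \<times> ({..<2 * g} \<rightarrow>\<^sub>E {0..<int p})"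
  have "inj_on (case_prod normal_form) B"
  proof (rule inj_onI, clarify)
    fix k l e e'
    assume *: "(k, e) \<in> B" "(l, e') \<in> B" "normal_form k e = normal_form l e'"
    from *(3) have "int p dvd e i - e' i" if "i < 2 * g" for i
      using that by (simp add: normal_form_eq_iff normal_form_eq_one_iff)
    moreover have "e i \<in> {0..<int p}" "e' i \<in> {0..<int p}" if "i < 2 * g" for i
      using * that by (auto simp: B_def PiE_iff)
    ultimately have "e i = e' i" if "i < 2 * g" for i
      using that by (metis atLeastLessThan_iff mod_eq_dvd_iff mod_pos_pos_trivial)
    then have e: "e = e'"
      using * unfolding B_def by (intro PiE_ext[of e "{..<2 * g}" _ e']) auto
    have "w [^] k \<otimes> ordered_prod t e (2 * g) = w [^] l \<otimes> ordered_prod t e (2 * g)"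
      using *(3) by (simp add: normal_form_def e)
    then have "[k = l] (mod int p)" by (simp add: w_pow_eq_iff)
    then have "k = l" using * by (simp add: B_def cong_def)
    with e show "k = l \<and> e = e'" by simp
  qed
  then have "card (case_prod normal_form ` B) = card B" by (rule card_image)
  also have "card B = order G"
    by (simp add: B_def card_cartesian_product card_PiE order_G)
  finally have "case_prod normal_form ` B = carrier G"
    by (intro card_subset_eq finite_carrier) (auto simp: order_def)
  then have "x \<in> case_prod normal_form ` B" using assms by simp
  then show thesis by (auto intro: that)
qed

end

text \<open>
  Sending each normal form for the first frame to the normal form with the same exponents
  for the second is well defined, injective and multiplicative, because equality and multiplication
  of normal forms are governed by data that both frames share.
\<close>

lemma exists_automorphism:
  assumes "symplectic_frame G w p g t c" and "symplectic_frame G w' p g t' c"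
  shows "\<exists>\<alpha>\<in>auto G. \<alpha> w = w' \<and> (\<forall>i<2 * g. \<alpha> (t i) = t' i)"
proof -
  interpret F: symplectic_frame G w p g t c by fact
  interpret F': symplectic_frame G w' p g t' c by fact
  have eq_iff: "F.normal_form k e = F.normal_form l e' \<longleftrightarrow>
      F'.normal_form k e = F'.normal_form l e'" for k e l e'
    by (simp add: F.normal_form_eq_iff F'.normal_form_eq_iff
      F.normal_form_eq_one_iff F'.normal_form_eq_one_iff)
  define coords where "coords x = (SOME ke. x = case_prod F.normal_form ke)" for x
  define \<alpha> where "\<alpha> = (\<lambda>x\<in>carrier G. case_prod F'.normal_form (coords x))"
  have \<alpha>: "\<alpha> (F.normal_form k e) = F'.normal_form k e" for k e
  proof -
    have "F.normal_form k e = case_prod F.normal_form (coords (F.normal_form k e))"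
      unfolding coords_def by (rule someI[of _ "(k, e)"]) simp
    then have "F'.normal_form k e = case_prod F'.normal_form (coords (F.normal_form k e))"
      by (metis case_prod_beta' eq_iff)
    then show ?thesis by (simp add: \<alpha>_def)
  qed
  have "\<alpha> \<in> hom G G"
  proof (rule homI)
    fix x y assume "x \<in> carrier G" "y \<in> carrier G"
    then obtain k e l e' where "x = F.normal_form k e" "y = F.normal_form l e'"
      using F.normal_form_surj by metis
    then show "\<alpha> (x \<otimes>\<^bsub>G\<^esub> y) = \<alpha> x \<otimes>\<^bsub>G\<^esub> \<alpha> y"
      by (simp add: \<alpha> F.normal_form_mult F'.normal_form_mult)
  next
    fix x assume "x \<in> carrier G"
    then show "\<alpha> x \<in> carrier G" by (metis F.normal_form_surj \<alpha> F'.normal_form_closed)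
  qed
  moreover have "\<alpha> \<in> Bij (carrier G)"
  proof -
    have "inj_on \<alpha> (carrier G)"
      by (rule inj_onI) (metis F.normal_form_surj \<alpha> eq_iff)
    moreover have "\<alpha> ` carrier G = carrier G"
      using \<open>inj_on \<alpha> (carrier G)\<close> \<open>\<alpha> \<in> hom G G\<close> F.finite_carrier
      by (intro endo_inj_surj) (auto simp: hom_def)
    ultimately show ?thesis by (simp add: Bij_def bij_betw_def \<alpha>_def)
  qed
  moreover have "\<alpha> w = w'"
    using \<alpha>[of 1 "\<lambda>i. 0"] by (simp add: F.normal_form_zero F'.normal_form_zero)
  moreover have "\<alpha> (t i) = t' i" if "i < 2 * g" for i
    using \<alpha>[of 0 "\<lambda>j. if j = i then 1 else 0"] that
    by (simp add: F.normal_form_unit F'.normal_form_unit)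
  ultimately show ?thesis unfolding auto_def by blast
qed


section \<open>Transvections and the values of the power map\<close>

text \<open>
  The standard symplectic form on coefficient vectors, with a sign that makes \<open>pairing g c d\<close> the
  exponent of the \<open>p\<close>-th power of the element \<open>u\<close> along which \<open>transvection\<close> moves \<open>c\<close> to \<open>d\<close>.
\<close>

definition pairing :: "nat \<Rightarrow> (nat \<Rightarrow> int) \<Rightarrow> (nat \<Rightarrow> int) \<Rightarrow> int"
  where "pairing g c d = (\<Sum>i<g. c (i + g) * d i - c i * d (i + g))"

lemma sum_lessThan_add:
  fixes f :: "nat \<Rightarrow> int"
  shows "(\<Sum>i<m + n. f i) = (\<Sum>i<m. f i) + (\<Sum>i<n. f (m + i))"
  by (induction n) simp_all

lemma pairing_add: "pairing g c (\<lambda>i. d i + e i) = pairing g c d + pairing g c e"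
  unfolding pairing_def sum.distrib [symmetric] by (intro sum.cong) (simp_all add: algebra_simps)

lemma pairing_anti: "pairing g d c = - pairing g c d"
  unfolding pairing_def sum_negf [symmetric] by (intro sum.cong) (simp_all add: algebra_simps)

lemma pairing_nondegenerate:
  assumes "i < 2 * g" "\<not> q dvd c i"
  obtains e where "\<not> q dvd pairing g c e"
proof (cases "i < g")
  case True
  have "pairing g c (\<lambda>j. if j = i + g then 1 else 0) = (\<Sum>j<g. if j = i then - c i else 0)"
    unfolding pairing_def using True by (intro sum.cong) auto
  then have "pairing g c (\<lambda>j. if j = i + g then 1 else 0) = - c i"
    using True by simp
  with assms that show thesis by (metis dvd_minus_iff)
next
  case False
  have "pairing g c (\<lambda>j. if j = i - g then 1 else 0) = (\<Sum>j<g. if j = i - g then c i else 0)"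
    unfolding pairing_def using False assms(1) by (intro sum.cong) auto
  then have "pairing g c (\<lambda>j. if j = i - g then 1 else 0) = c i"
    using False assms(1) by simp
  with assms that show thesis by metis
qed

text \<open>
  By nondegeneracy the pairing with \<open>c\<close> is nonzero modulo \<open>q\<close> at some \<open>e\<close>, and the pairing with
  \<open>d\<close> at some \<open>e'\<close>. One of \<open>e\<close>, \<open>e'\<close> and \<open>e + e'\<close> then serves for both.
\<close>

lemma pairing_connect:
  assumes "i < 2 * g" "\<not> q dvd c i" "j < 2 * g" "\<not> q dvd d j"
  obtains e where "\<not> q dvd pairing g c e" "\<not> q dvd pairing g e d"
proof -
  obtain e where e: "\<not> q dvd pairing g c e"
    using assms(1,2) by (rule pairing_nondegenerate)
  obtain e' where "\<not> q dvd pairing g d e'"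
    using assms(3,4) by (rule pairing_nondegenerate)
  then have e': "\<not> q dvd pairing g e' d" by (simp add: pairing_anti[of g e'])
  show thesis
  proof (cases "q dvd pairing g e d \<and> q dvd pairing g c e'")
    case True
    have "\<not> q dvd pairing g c (\<lambda>i. e i + e' i)"
      using True e by (simp add: pairing_add dvd_add_left_iff)
    moreover have "\<not> q dvd pairing g (\<lambda>i. e i + e' i) d"
      using True e' unfolding pairing_anti[of g _ d] pairing_add dvd_minus_iff
      by (simp add: dvd_add_right_iff)
    ultimately show thesis by (rule that)
  next
    case False
    with e e' that show thesis by blast
  qed
qed

context symplectic_frame
begin

lemma normal_form_pow_p:
  assumes "odd p"
  shows "normal_form 0 e [^] p = w [^] (\<Sum>i<2 * g. c i * e i)"
  using assms unfolding normal_form_def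
  by (simp add: ordered_prod_pow_p[where c = c and J = "symp g"] t_closed t_comm_exp t_pow_p)

text \<open>
  Choose \<open>u\<close> such that the commutator of \<open>t i\<close> with \<open>u\<close> has exponent \<open>\<delta> i = d i - c i\<close>. Replacing \<open>t i\<close> by
  \<open>t i \<otimes> u [^] (k * \<delta> i)\<close> is a symplectic transvection, so commutators are preserved, and it adds
  \<open>k * \<delta> i\<close> times the exponent of \<open>u [^] p\<close> to \<open>c i\<close>. That exponent is \<open>pairing g c d\<close>; taking \<open>k\<close> to be its inverse
  modulo \<open>p\<close> turns \<open>c\<close> into \<open>d\<close>.
\<close>

lemma transvection:
  assumes "odd p" and "\<not> int p dvd pairing g c d"
  obtains t' where "symplectic_frame G w p g t' d"
proof -
  define \<delta> where "\<delta> i = d i - c i" for i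
  \<comment> \<open>Dualising \<delta>: by the formula for commutators with normal forms, t j and u have commutator exponent \<delta> j.\<close>
  define e where "e i = (if i < g then - \<delta> (i + g) else \<delta> (i - g))" for i
  define u where "u = normal_form 0 e"
  have u [simp]: "u \<in> carrier G" by (simp add: u_def)
  have tu: "comm_exp (t j) u (\<delta> j)" if "j < 2 * g" for j
  proof -
    have "(if j < g then - e (j + g) else e (j - g)) = - \<delta> j"
      using that by (auto simp: e_def)
    then have "comm_exp u (t j) (- \<delta> j)"
      using comm_exp_normal_form[OF that, of 0 e] by (simp add: u_def)
    then have "comm_exp (t j) u (- (- \<delta> j))"
      by (rule comm_exp_sym[OF _ u t_closed[OF that]])
    then show ?thesis by simp
  qed
  have "(\<Sum>i<2 * g. c i * e i) = pairing g c d"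
  proof -
    have "(\<Sum>i<2 * g. c i * e i) = (\<Sum>i<g. c i * e i) + (\<Sum>i<g. c (i + g) * e (i + g))"
      by (simp add: mult_2 sum_lessThan_add add.commute)
    also have "\<dots> = (\<Sum>i<g. c i * e i + c (i + g) * e (i + g))"
      by (simp add: sum.distrib)
    also have "\<dots> = pairing g c d"
      unfolding pairing_def by (intro sum.cong) (simp_all add: e_def \<delta>_def algebra_simps)
    finally show ?thesis .
  qed
  then have u_pow: "u [^] p = w [^] pairing g c d"
    using \<open>odd p\<close> by (simp add: u_def normal_form_pow_p)
  have "coprime (pairing g c d) (int p)"
    using assms(2) prime_p by (simp add: coprime_commute prime_imp_coprime)
  then obtain k where k: "[pairing g c d * k = 1] (mod int p)"
    using coprime_iff_invertible_int[of "pairing g c d" "int p"] by blast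
  define t' where "t' i = t i \<otimes> u [^] (k * \<delta> i)" for i
  have t'_closed: "t' i \<in> carrier G" if "i < 2 * g" for i
    using that by (simp add: t'_def t_closed)
  \<comment> \<open>The two new contributions to a commutator, k * \<delta> i * \<delta> j with opposite signs, cancel.\<close>
  have "symplectic_frame G w p g t' d"
  proof unfold_locales
    show "t' i \<in> carrier G" if "i < 2 * g" for i by (rule t'_closed[OF that])
  next
    fix i j assume ij: "i < 2 * g" "j < 2 * g"
    have "comm_exp u u 0" by (simp add: comm_exp_def)
    moreover have "comm_exp u (t j) (- \<delta> j)" using tu[OF ij(2)] ij by (simp add: comm_exp_sym t_closed)
    ultimately have "comm_exp (t i \<otimes> u [^] (k * \<delta> i)) (t j \<otimes> u [^] (k * \<delta> j))
      ((symp g i j + k * \<delta> j * \<delta> i) + (k * \<delta> i * (- \<delta> j + k * \<delta> j * 0)))"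
      using ij
      by (intro comm_exp_mult_left comm_exp_pow_left comm_exp_mult_right comm_exp_pow_right
        t_comm_exp tu t_closed int_pow_closed m_closed u)
    moreover have "(symp g i j + k * \<delta> j * \<delta> i) + (k * \<delta> i * (- \<delta> j + k * \<delta> j * 0)) = symp g i j"
      by (simp add: algebra_simps)
    ultimately show "comm_exp (t' i) (t' j) (symp g i j)" by (simp only: t'_def)
  next
    fix i assume i: "i < 2 * g"
    have "comm_exp (u [^] (k * \<delta> i)) (t i) (k * \<delta> i * - \<delta> i)"
      using tu[OF i] i by (intro comm_exp_pow_left comm_exp_sym t_closed u)
    then have "t' i [^] p = t i [^] p \<otimes> (u [^] (k * \<delta> i)) [^] p"
      unfolding t'_def using \<open>odd p\<close> i by (intro pow_p_mult t_closed int_pow_closed u)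
    also have "(u [^] (k * \<delta> i)) [^] p = (u [^] p) [^] (k * \<delta> i)"
      by (simp add: int_pow_pow mult.commute flip: int_pow_int)
    also have "t i [^] p \<otimes> \<dots> = w [^] (c i + pairing g c d * k * \<delta> i)"
      using i by (simp add: u_pow t_pow_p int_pow_pow int_pow_mult mult.assoc)
    also have "\<dots> = w [^] d i"
    proof -
      have "[c i + pairing g c d * k * \<delta> i = c i + 1 * \<delta> i] (mod int p)"
        using k by (intro cong_add cong_mult) simp_all
      then show ?thesis by (simp add: w_pow_eq_iff \<delta>_def)
    qed
    finally show "t' i [^] p = w [^] d i" .
  qed (rule order_G)
  then show thesis by (rule that)
qed

lemma exists_frame_with_powers:
  assumes "odd p" and "i < 2 * g" "\<not> int p dvd c i" "j < 2 * g" "\<not> int p dvd d j"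
  obtains t' where "symplectic_frame G w p g t' d"
proof -
  obtain e where ce: "\<not> int p dvd pairing g c e" and ed: "\<not> int p dvd pairing g e d"
    using assms(2-) by (rule pairing_connect)
  obtain s where "symplectic_frame G w p g s e"
    by (rule transvection[OF \<open>odd p\<close> ce])
  then show thesis
    by (rule symplectic_frame.transvection[OF _ \<open>odd p\<close> ed]) (rule that)
qed

lemma subgroup_containing_frame:
  assumes "subgroup K G" "w \<in> K" "\<And>i. i < 2 * g \<Longrightarrow> t i \<in> K"
  shows "K = carrier G"
proof
  interpret K: subgroup K G by fact
  have "ordered_prod t e n \<in> K" if "n \<le> 2 * g" for e n
    using that by (induction n) (auto intro!: K.m_closed subgroup_int_pow_closed[OF assms(1)] assms(3))
  then have "normal_form k e \<in> K" for k e
    unfolding normal_form_def using assms(2) by (intro K.m_closed subgroup_int_pow_closed[OF assms(1)]) simp_all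
  then show "carrier G \<subseteq> K" by (metis normal_form_surj subsetI)
qed (use assms(1) subgroup.subset in blast)

text \<open>
  The \<open>p\<close>-th power map is multiplicative for odd \<open>p\<close>, so it is trivial as soon as it is
  trivial on a frame.
\<close>

lemma exponent_p:
  assumes "odd p" "\<And>i. i < 2 * g \<Longrightarrow> int p dvd c i" "x \<in> carrier G"
  shows "x [^] p = \<one>"
proof -
  obtain k e where x: "x = normal_form k e" using assms(3) by (rule normal_form_surj)
  have "x = w [^] k \<otimes> normal_form 0 e" by (simp add: x normal_form_def)
  also have "(w [^] k \<otimes> normal_form 0 e) [^] p = (w [^] k) [^] p \<otimes> normal_form 0 e [^] p"
    by (intro pow_mult_distrib) (simp_all add: w_pow_central)
  also have "(w [^] k) [^] p = w [^] (k * int p)"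
    by (simp add: int_pow_pow flip: int_pow_int)
  also have "\<dots> = \<one>" by (simp add: w_pow_eq_one_iff)
  also have "normal_form 0 e [^] p = w [^] (\<Sum>i<2 * g. c i * e i)"
    using assms(1) by (rule normal_form_pow_p)
  also have "\<dots> = \<one>"
    unfolding w_pow_eq_one_iff using assms(2) by (intro dvd_sum) auto
  finally show ?thesis by simp
qed

end


section \<open>Homomorphisms out of presented groups\<close>

definition word_val :: "('a, 'b) monoid_scheme \<Rightarrow> ('x \<Rightarrow> 'a) \<Rightarrow> 'x word \<Rightarrow> 'a"
  where "word_val G f u =
    foldr (\<lambda>(x, e) a. (if e then f x else inv\<^bsub>G\<^esub> f x) \<otimes>\<^bsub>G\<^esub> a) u \<one>\<^bsub>G\<^esub>"

lemma words_gen [simp]: "gen x \<in> words S \<longleftrightarrow> x \<in> S"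
  by (simp add: gen_def)

lemma words_wpow [simp]: "u \<in> words S \<Longrightarrow> wpow n u \<in> words S"
  by (induction n) (auto simp: wpow_def)

lemma words_wcomm [simp]: "wcomm u v \<in> words S \<longleftrightarrow> u \<in> words S \<and> v \<in> words S"
  by (auto simp: wcomm_def)

lemma words_concat: "(\<And>u. u \<in> set us \<Longrightarrow> u \<in> words S) \<Longrightarrow> concat us \<in> words S"
  by (induction us) auto

locale group_valuation = group G for G (structure) +
  fixes S :: "'x set" and f :: "'x \<Rightarrow> 'a"
  assumes f_closed: "x \<in> S \<Longrightarrow> f x \<in> carrier G"
begin

lemma word_val_in_subgroup:
  assumes "subgroup K G" "\<And>x. x \<in> S \<Longrightarrow> f x \<in> K" "u \<in> words S"
  shows "word_val G f u \<in> K"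
proof -
  interpret K: subgroup K G by fact
  show ?thesis
    using assms(3)
  proof (induction u)
    case Nil
    show ?case by (simp add: word_val_def)
  next
    case (Cons l u)
    then show ?case by (cases l) (simp add: word_val_def assms(2))
  qed
qed

lemma word_val_closed [simp]: "u \<in> words S \<Longrightarrow> word_val G f u \<in> carrier G"
  using word_val_in_subgroup[OF subgroup_self] f_closed by blast

lemma word_val_Nil [simp]: "word_val G f [] = \<one>"
  by (simp add: word_val_def)

lemma word_val_gen [simp]: "x \<in> S \<Longrightarrow> word_val G f (gen x) = f x"
  by (simp add: word_val_def gen_def f_closed)

lemma word_val_append [simp]:
  assumes "u \<in> words S" "v \<in> words S"
  shows "word_val G f (u @ v) = word_val G f u \<otimes> word_val G f v"
  using assms(1)
proof (induction u)
  case Nil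
  then show ?case using assms by simp
next
  case (Cons l u)
  have "word_val G f (l # w) = (if snd l then f (fst l) else inv f (fst l)) \<otimes> word_val G f w" for w
    by (cases l) (simp add: word_val_def)
  then show ?case using Cons assms(2) by (simp add: m_assoc f_closed)
qed

lemma word_val_winv [simp]:
  assumes "u \<in> words S"
  shows "word_val G f (winv u) = inv word_val G f u"
  using assms
proof (induction u)
  case Nil
  then show ?case by (simp add: winv_def)
next
  case (Cons l u)
  obtain x e where l: "l = (x, e)" by (cases l)
  then have x: "x \<in> S" "u \<in> words S" using Cons.prems by auto
  have "winv (l # u) = winv u @ [(x, \<not> e)]" "l # u = [(x, e)] @ u"
    by (simp_all add: winv_def l)
  moreover have val: "word_val G f [(x, b)] = (if b then f x else inv f x)" for b
    using x by (simp add: word_val_def f_closed)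
  ultimately have "word_val G f (winv (l # u)) = inv word_val G f u \<otimes> word_val G f [(x, \<not> e)]"
    and "word_val G f (l # u) = word_val G f [(x, e)] \<otimes> word_val G f u"
    using x Cons.IH by (simp_all only: word_val_append words_simps fst_conv simp_thms)
  then show ?case
    using x by (simp add: val inv_mult_group f_closed)
qed

lemma word_val_wpow [simp]: "u \<in> words S \<Longrightarrow> word_val G f (wpow n u) = word_val G f u [^] n"
proof (induction n)
  case 0
  then show ?case by (simp add: wpow_def)
next
  case (Suc n)
  have "wpow (Suc n) u = u @ wpow n u" by (simp add: wpow_def)
  with Suc show ?case by (simp flip: nat_pow_Suc2)
qed

lemma word_val_wcomm [simp]:
  assumes "u \<in> words S" "v \<in> words S"
  shows "word_val G f (wcomm u v)
    = word_val G f u \<otimes> word_val G f v \<otimes> inv word_val G f u \<otimes> inv word_val G f v"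
  using assms by (simp add: wcomm_def m_assoc)

lemma word_val_word_cong:
  assumes "\<And>u v. (u, v) \<in> R \<Longrightarrow> word_val G f u = word_val G f v"
    and "(u, v) \<in> word_cong S R"
  shows "word_val G f u = word_val G f v"
  using assms(2)
proof (induction rule: word_cong.induct)
  case (wc_append u u' v v')
  then show ?case by (simp add: word_cong_words)
next
  case (wc_cancel x e)
  then show ?case by (simp add: word_val_def f_closed)
qed (simp_all add: assms(1))

lemma exists_presented_hom:
  assumes "\<And>u v. (u, v) \<in> R \<Longrightarrow> word_val G f u = word_val G f v"
  shows "\<exists>\<phi>\<in>hom (presented_group S R) G. \<phi> \<in> extensional (carrier (presented_group S R)) \<and>
    (\<forall>u\<in>words S. \<phi> (word_class S R u) = word_val G f u)"
proof -
  define rep where "rep U = (SOME u. u \<in> words S \<and> U = word_class S R u)" for U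
  define \<phi> where "\<phi> = (\<lambda>U\<in>carrier (presented_group S R). word_val G f (rep U))"
  have val: "\<phi> (word_class S R u) = word_val G f u" if "u \<in> words S" for u
  proof -
    define v where "v = rep (word_class S R u)"
    have "\<exists>v. v \<in> words S \<and> word_class S R u = word_class S R v"
      using that by blast
    then have "v \<in> words S \<and> word_class S R u = word_class S R v"
      unfolding v_def rep_def by (rule someI_ex)
    then have "(u, v) \<in> word_cong S R"
      using that by (simp flip: word_class_eq_iff)
    then have "word_val G f u = word_val G f v"
      by (rule word_val_word_cong[rotated]) (rule assms)
    then show ?thesis using that by (simp add: \<phi>_def carrier_presented_group v_def)
  qed
  have "\<phi> \<in> hom (presented_group S R) G"
    by (rule homI) (auto simp: carrier_presented_group val mult_presented_group)
  moreover have "\<phi> \<in> extensional (carrier (presented_group S R))" by (simp add: \<phi>_def)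
  ultimately show ?thesis using val by blast
qed

end

lemma presented_hom_word_val:
  assumes "group G" and \<phi>: "\<phi> \<in> hom (presented_group S R) G"
  defines "f \<equiv> \<lambda>x. \<phi> (word_class S R (gen x))"
  shows "group_valuation G S f"
    and "\<And>u. u \<in> words S \<Longrightarrow> \<phi> (word_class S R u) = word_val G f u"
    and "\<And>u v. (u, v) \<in> R \<Longrightarrow> u \<in> words S \<Longrightarrow> v \<in> words S \<Longrightarrow> word_val G f u = word_val G f v"
proof -
  interpret group G by fact
  interpret P: group "presented_group S R" by (rule group_presented_group)
  interpret \<phi>: group_hom "presented_group S R" G \<phi>
    using \<phi> by unfold_locales
  show "group_valuation G S f"
    by unfold_locales (auto simp: f_def carrier_presented_group intro!: \<phi>.hom_closed)
  then interpret group_valuation G S f .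
  show val: "\<phi> (word_class S R u) = word_val G f u" if "u \<in> words S" for u
    using that
  proof (induction u)
    case Nil
    then show ?case using \<phi>.hom_one by (simp add: one_presented_group)
  next
    case (Cons l u)
    obtain x e where l: "l = (x, e)" by (cases l)
    then have x: "x \<in> S" "u \<in> words S" using Cons.prems by auto
    have w: "[(x, b)] \<in> words S" for b using x by simp
    have T: "\<phi> (word_class S R [(x, True)]) = f x" by (simp add: f_def gen_def)
    have cl: "word_class S R v \<in> carrier (presented_group S R)" if "v \<in> words S" for v
      using that by (auto simp: carrier_presented_group)
    have "word_class S R [(x, False)] \<otimes>\<^bsub>presented_group S R\<^esub> word_class S R [(x, True)]
        = \<one>\<^bsub>presented_group S R\<^esub>"
      using wc_cancel[OF x(1), of False R] w
      by (simp add: mult_presented_group one_presented_group word_class_eq_iff x(1))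
    then have "\<phi> (word_class S R [(x, False)]) = inv\<^bsub>G\<^esub> f x"
      using cl[OF w] T
      by (metis P.inv_equality \<phi>.hom_inv)
    then have letter: "\<phi> (word_class S R [l]) = word_val G f [l]"
      using T x by (cases e) (simp_all add: l word_val_def f_closed)
    have "\<phi> (word_class S R ([l] @ u)) = \<phi> (word_class S R [l] \<otimes>\<^bsub>presented_group S R\<^esub> word_class S R u)"
      using x l by (simp add: mult_presented_group)
    also have "\<dots> = \<phi> (word_class S R [l]) \<otimes>\<^bsub>G\<^esub> \<phi> (word_class S R u)"
      using x l by (intro \<phi>.hom_mult cl) simp_all
    also have "\<dots> = word_val G f ([l] @ u)"
      using Cons.IH x l letter by (subst word_val_append) simp_all
    finally show ?case by simp
  qed
  show "word_val G f u = word_val G f v"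
    if "(u, v) \<in> R" "u \<in> words S" "v \<in> words S" for u v
  proof -
    have "word_class S R u = word_class S R v"
      using wc_rel[OF that] that(2,3) by (simp add: word_class_eq_iff)
    then show ?thesis using val[OF that(2)] val[OF that(3)] by simp
  qed
qed

lemma presented_hom_ext:
  assumes "group G"
    and "\<phi> \<in> hom (presented_group S R) G" "\<phi> \<in> extensional (carrier (presented_group S R))"
    and "\<psi> \<in> hom (presented_group S R) G" "\<psi> \<in> extensional (carrier (presented_group S R))"
    and gens: "\<And>x. x \<in> S \<Longrightarrow> \<phi> (word_class S R (gen x)) = \<psi> (word_class S R (gen x))"
  shows "\<phi> = \<psi>"
proof (rule extensionalityI[OF assms(3,5)])
  fix U assume "U \<in> carrier (presented_group S R)"
  then obtain u where u: "u \<in> words S" "U = word_class S R u"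
    by (auto simp: carrier_presented_group)
  have "word_val G (\<lambda>x. \<phi> (word_class S R (gen x))) u = word_val G (\<lambda>x. \<psi> (word_class S R (gen x))) u"
    using u(1) by (induction u) (auto simp: word_val_def gens)
  then show "\<phi> U = \<psi> U"
    using presented_hom_word_val(2)[OF assms(1,2) u(1)] presented_hom_word_val(2)[OF assms(1,4) u(1)]
    by (simp only: u(2))
qed

lemma presented_epi_subgroup:
  assumes "group G" "\<phi> \<in> epi (presented_group S R) G" "subgroup K G"
    and "\<And>x. x \<in> S \<Longrightarrow> \<phi> (word_class S R (gen x)) \<in> K"
  shows "K = carrier G"
proof
  have hom: "\<phi> \<in> hom (presented_group S R) G" using assms(2) by (simp add: epi_def)
  show "carrier G \<subseteq> K"
  proof
    fix y assume "y \<in> carrier G"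
    then obtain u where "u \<in> words S" "y = \<phi> (word_class S R u)"
      using assms(2) by (auto simp: epi_def carrier_presented_group)
    moreover have "word_val G (\<lambda>x. \<phi> (word_class S R (gen x))) u \<in> K"
      by (rule group_valuation.word_val_in_subgroup[OF presented_hom_word_val(1)[OF assms(1) hom] assms(3,4)])
        (use \<open>u \<in> words S\<close> in simp_all)
    ultimately show "y \<in> K"
      using presented_hom_word_val(2)[OF assms(1) hom] by simp
  qed
qed (use assms(3) subgroup.subset in blast)

lemma (in group) subgroup_centralizer:
  assumes [simp]: "y \<in> carrier G"
  shows "subgroup {x \<in> carrier G. x \<otimes> y = y \<otimes> x} G"
proof (rule subgroupI)
  fix a b assume "a \<in> {x \<in> carrier G. x \<otimes> y = y \<otimes> x}" "b \<in> {x \<in> carrier G. x \<otimes> y = y \<otimes> x}"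
  then have ab: "a \<in> carrier G" "b \<in> carrier G" "a \<otimes> y = y \<otimes> a" "b \<otimes> y = y \<otimes> b" by auto
  have "a \<otimes> b \<otimes> y = a \<otimes> y \<otimes> b" using ab(1,2,4) by (simp add: m_assoc)
  also have "\<dots> = y \<otimes> (a \<otimes> b)" unfolding ab(3) using ab by (simp add: m_assoc)
  finally show "a \<otimes> b \<in> {x \<in> carrier G. x \<otimes> y = y \<otimes> x}" using ab by simp
next
  have "\<one> \<in> {x \<in> carrier G. x \<otimes> y = y \<otimes> x}" by simp
  then show "{x \<in> carrier G. x \<otimes> y = y \<otimes> x} \<noteq> {}" by blast
qed (auto intro: commute_inv)

lemma (in group) subgroup_center: "subgroup (center G) G"
proof -
  have "center G = (\<Inter>y\<in>carrier G. {x \<in> carrier G. x \<otimes> y = y \<otimes> x})"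
    using one_closed by (auto simp: center_def)
  moreover have "subgroup \<dots> G"
    by (rule subgroups_Inter) (use subgroup_centralizer one_closed in auto)
  ultimately show ?thesis by simp
qed

lemma (in group) normal_center: "center G \<lhd> G"
proof (rule normal_invI)
  fix x h assume "x \<in> carrier G" "h \<in> center G"
  then have "h \<in> carrier G" "x \<otimes> h = h \<otimes> x" by (auto simp: center_def)
  then have "x \<otimes> h \<otimes> inv x = h"
    using \<open>x \<in> carrier G\<close> by (simp add: m_assoc)
  with \<open>h \<in> center G\<close> show "x \<otimes> h \<otimes> inv x \<in> center G" by simp
qed (rule subgroup_center)


section \<open>Extra-special groups\<close>

locale extra_special_group = group G for G (structure) +
  fixes p g :: nat
  assumes prime_p: "Factorial_Ring.prime p" and odd_p: "odd p" and g_pos: "g > 0"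
    and extra_special: "extra_special p G" and order_G: "order G = p ^ (2 * g + 1)"
begin

lemma card_center: "card (center G) = p"
  using extra_special by (simp add: extra_special_def)

lemma center_closed [simp]: "z \<in> center G \<Longrightarrow> z \<in> carrier G"
  by (simp add: center_def)

lemma mult_mod_center:
  assumes "x \<in> carrier G" "y \<in> carrier G"
  obtains z where "z \<in> center G" "x \<otimes> y = z \<otimes> (y \<otimes> x)"
proof -
  interpret N: normal "center G" G by (rule normal_center)
  interpret Q: comm_group "G Mod center G"
    using extra_special by (simp add: extra_special_def elementary_abelian_def)
  have "center G #> (x \<otimes> y) = (center G #> x) \<otimes>\<^bsub>G Mod center G\<^esub> (center G #> y)"
    using assms by (simp add: N.rcos_sum)
  also have "\<dots> = (center G #> y) \<otimes>\<^bsub>G Mod center G\<^esub> (center G #> x)"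
    using assms by (intro Q.m_comm) (auto simp: carrier_FactGroup)
  also have "\<dots> = center G #> (y \<otimes> x)"
    using assms by (simp add: N.rcos_sum)
  finally have "center G #> (x \<otimes> y) = center G #> (y \<otimes> x)" .
  moreover have "x \<otimes> y \<in> center G #> (x \<otimes> y)"
    using assms by (intro rcos_self subgroup_center m_closed)
  ultimately have "x \<otimes> y \<in> center G #> (y \<otimes> x)" by simp
  then show thesis using that by (auto simp: r_coset_def)
qed

lemma pow_p_in_center:
  assumes "x \<in> carrier G"
  shows "x [^] p \<in> center G"
proof -
  interpret N: normal "center G" G by (rule normal_center)
  have "(center G #> x) [^]\<^bsub>G Mod center G\<^esub> p = \<one>\<^bsub>G Mod center G\<^esub>"
    using extra_special assms
    by (auto simp: extra_special_def elementary_abelian_def carrier_FactGroup)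
  then have "center G #> (x [^] p) = center G"
    using assms by (simp add: N.FactGroup_pow)
  moreover have "x [^] p \<in> center G #> (x [^] p)"
    using assms by (intro rcos_self subgroup_center nat_pow_closed)
  ultimately show ?thesis by simp
qed

lemma central_prime_element:
  assumes "w \<in> center G" "w \<noteq> \<one>"
  shows "central_prime_element G w p"
proof unfold_locales
  interpret Z: group "G\<lparr>carrier := center G\<rparr>"
    using subgroup_center by (rule subgroup.subgroup_is_group) (rule group_axioms)
  have "w [^]\<^bsub>G\<lparr>carrier := center G\<rparr>\<^esub> order (G\<lparr>carrier := center G\<rparr>) = \<one>"
    using Z.pow_order_eq_1 assms(1) by simp
  then show "w [^] p = \<one>"
    by (simp add: order_def card_center flip: nat_pow_consistent)
next
  show "w \<otimes> x = x \<otimes> w" if "x \<in> carrier G" for x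
    using assms(1) that unfolding center_def by blast
qed (use assms prime_p in simp_all)

lemma center_eq_powers:
  assumes "w \<in> center G" "w \<noteq> \<one>" "z \<in> center G"
  obtains k where "k \<in> {0..<int p}" "z = w [^] k"
proof -
  interpret central_prime_element G w p using assms(1,2) by (rule central_prime_element)
  have "inj_on (\<lambda>k::int. w [^] k) {0..<int p}"
    by (rule inj_onI) (simp add: w_pow_eq_iff cong_def)
  then have "card ((\<lambda>k::int. w [^] k) ` {0..<int p}) = card (center G)"
    by (simp add: card_image card_center)
  moreover have "(\<lambda>k::int. w [^] k) ` {0..<int p} \<subseteq> center G"
    using assms(1) subgroup_center by (auto intro: subgroup_int_pow_closed)
  moreover have "finite (center G)"
    using card_center prime_gt_0_nat[OF prime_p] by (intro card_ge_0_finite) simp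
  ultimately have "(\<lambda>k::int. w [^] k) ` {0..<int p} = center G"
    by (intro card_subset_eq)
  with assms(3) have "z \<in> (\<lambda>k::int. w [^] k) ` {0..<int p}" by simp
  then show thesis using that by auto
qed

lemma not_abelian: "center G \<noteq> carrier G"
proof
  assume "center G = carrier G"
  then have "p ^ (2 * g + 1) = p ^ 1"
    using card_center order_G unfolding order_def power_one_right by metis
  moreover have "1 < p" using prime_p by (rule prime_gt_1_nat)
  ultimately have "2 * g + 1 = 1" by (simp only: power_inject_exp)
  with g_pos show False by simp
qed

text \<open>
  The order of \<open>s\<close> is odd, so \<open>s\<close> is a power of its square.
\<close>

lemma square_central_imp_central:
  assumes "s \<in> carrier G" "s [^] (2::nat) \<in> center G"
  shows "s \<in> center G"
proof -
  define N where "N = p ^ (2 * g + 1)"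
  have "odd N" using odd_p by (simp add: N_def)
  then have "even (N + 1)" by simp
  then obtain m where m: "N + 1 = 2 * m" by (rule evenE)
  have "s [^] N = \<one>" using pow_order_eq_1[OF assms(1)] by (simp add: N_def order_G)
  then have "s = s [^] (N + 1)" using assms(1) by simp
  also have "\<dots> = (s [^] (2::nat)) [^] m" using assms(1) by (simp only: m nat_pow_pow)
  also have "\<dots> \<in> center G"
    using subgroup_int_pow_closed[OF subgroup_center assms(2), of "int m"] by (simp add: int_pow_int)
  finally show ?thesis .
qed

text \<open>
  The inverse of 2 modulo \<open>p\<close>, as an exponent: it extracts square roots of elements of order \<open>p\<close>.
\<close>

definition half :: nat where "half = (p + 1) div 2"

lemma two_half: "2 * half = p + 1"
  using odd_p by (simp add: half_def)

lemma frameI: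
  assumes "w \<in> center G" "w \<noteq> \<one>"
    and "\<And>i. i < 2 * g \<Longrightarrow> t i \<in> carrier G"
    and "\<And>i j. i < 2 * g \<Longrightarrow> j < 2 * g \<Longrightarrow> central_prime_element.comm_exp G w (t i) (t j) (symp g i j)"
  obtains c where "c \<in> {..<2 * g} \<rightarrow>\<^sub>E {0..<int p}" "symplectic_frame G w p g t c"
proof -
  interpret central_prime_element G w p using assms(1,2) by (rule central_prime_element)
  have "\<exists>k\<in>{0..<int p}. t i [^] p = w [^] k" if "i < 2 * g" for i
    using pow_p_in_center[OF assms(3)[OF that]] center_eq_powers[OF assms(1,2)] by metis
  then obtain c where c: "\<And>i. i < 2 * g \<Longrightarrow> c i \<in> {0..<int p} \<and> t i [^] p = w [^] c i"
    by metis
  have "symplectic_frame G w p g t (restrict c {..<2 * g})"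
    using assms(3,4) c order_G by unfold_locales auto
  then show thesis using c by (intro that[of "restrict c {..<2 * g}"]) auto
qed

end


section \<open>The braid relations in a group with central sigma\<close>

lemma (in group) commutator_eq_iff:
  assumes [simp]: "x \<in> carrier G" "y \<in> carrier G" "z \<in> carrier G"
  shows "x \<otimes> y \<otimes> inv x \<otimes> inv y = z \<longleftrightarrow> x \<otimes> y = z \<otimes> (y \<otimes> x)"
proof -
  have "x \<otimes> y \<otimes> inv x \<otimes> inv y = (x \<otimes> y) \<otimes> inv (y \<otimes> x)"
    by (simp add: inv_mult_group m_assoc)
  then show ?thesis by (metis assms inv_closed inv_solve_right m_closed)
qed

context central_prime_element
begin

lemma commutator_eq_w_pow_iff:
  assumes "x \<in> carrier G" "y \<in> carrier G"
  shows "x \<otimes> y \<otimes> inv x \<otimes> inv y = w [^] (k :: int) \<longleftrightarrow> comm_exp x y k"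
  using assms by (simp add: commutator_eq_iff comm_exp_def)

text \<open>
  Central factors do not change commutators. For \<open>\<sigma>\<close> mapped to a power of \<open>w\<close> this turns the braid
  relations into conditions on commutators of the \<open>a\<^sub>i\<close> and \<open>b\<^sub>i\<close>.
\<close>

lemma comm_exp_shift:
  assumes [simp]: "x \<in> carrier G" "y \<in> carrier G"
  shows "comm_exp x (w [^] (a :: int) \<otimes> (y \<otimes> w [^] (b :: int))) k \<longleftrightarrow> comm_exp x y k"
proof -
  have Y: "w [^] a \<otimes> (y \<otimes> w [^] b) = w [^] (a + b) \<otimes> y"
    by (simp add: w_pow_central[of y] w_pow_merge)
  have l: "x \<otimes> (w [^] (a + b) \<otimes> y) = w [^] (a + b) \<otimes> (x \<otimes> y)"
    by (simp add: w_pow_left[of x])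
  have r: "w [^] k \<otimes> (w [^] (a + b) \<otimes> y \<otimes> x) = w [^] (a + b) \<otimes> (w [^] k \<otimes> (y \<otimes> x))"
    by (simp add: m_assoc w_pow_merge add.commute)
  show ?thesis
    unfolding comm_exp_def Y l r by simp
qed

end

lemma braid_gens_simps [simp]:
  "BrA i \<in> braid_gens g \<longleftrightarrow> i \<in> {1..g}"
  "BrB i \<in> braid_gens g \<longleftrightarrow> i \<in> {1..g}"
  "BrSigma \<in> braid_gens g"
  by (auto simp: braid_gens_def)

lemma braid_rels_words:
  assumes "(u, v) \<in> braid_rels g"
  shows "u \<in> words (braid_gens g)" "v \<in> words (braid_gens g)"
  using assms by (auto simp: braid_rels_def Let_def intro!: words_concat)

definition braid_basis :: "nat \<Rightarrow> nat \<Rightarrow> braid_gen"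
  where "braid_basis g i = (if i < g then BrA (Suc i) else BrB (Suc (i - g)))"

lemma braid_basis_in_gens: "i < 2 * g \<Longrightarrow> braid_basis g i \<in> braid_gens g"
  by (auto simp: braid_basis_def)

text \<open>
  An assignment of the braid generators for which \<open>\<sigma>\<close> goes to a square root of \<open>w\<close>, so
  that the relations \<open>[a\<^sub>i, \<sigma>\<^sup>-\<^sup>1 b\<^sub>i \<sigma>\<^sup>-\<^sup>1] = \<sigma>\<^sup>2\<close> ask the commutators of the pairs to be \<open>w\<close>.
\<close>

locale braid_valuation = central_prime_element G w p + group_valuation G "braid_gens g" f
  for G (structure) and w p and g :: nat and f +
  fixes h :: int
  assumes f_sigma: "f BrSigma = w [^] h" and h: "[2 * h = 1] (mod int p)"
begin

lemma val_commutator_sigma: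
  assumes "x \<in> braid_gens g" "y \<in> braid_gens g"
  shows "word_val G f (wcomm (gen x) (winv (gen BrSigma) @ gen y @ winv (gen BrSigma)))
      = w [^] (k :: int) \<longleftrightarrow> comm_exp (f x) (f y) k"
    and "word_val G f (wcomm (gen x) (winv (gen BrSigma) @ gen y @ gen BrSigma))
      = w [^] (k :: int) \<longleftrightarrow> comm_exp (f x) (f y) k"
proof -
  have inv: "inv (w [^] h) = w [^] (- h)" by (simp add: int_pow_neg)
  show "word_val G f (wcomm (gen x) (winv (gen BrSigma) @ gen y @ winv (gen BrSigma)))
      = w [^] (k :: int) \<longleftrightarrow> comm_exp (f x) (f y) k"
    using assms comm_exp_shift[of "f x" "f y" "- h" "- h" k]
    by (simp add: f_closed f_sigma inv commutator_eq_w_pow_iff)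
  show "word_val G f (wcomm (gen x) (winv (gen BrSigma) @ gen y @ gen BrSigma))
      = w [^] (k :: int) \<longleftrightarrow> comm_exp (f x) (f y) k"
    using assms comm_exp_shift[of "f x" "f y" "- h" h k]
    by (simp add: f_closed f_sigma inv commutator_eq_w_pow_iff)
qed

lemma val_sigma_square: "word_val G f (wpow 2 (gen BrSigma)) = w [^] (1 :: int)"
proof -
  have "(w [^] h) [^] (2 :: nat) = w [^] (h * 2)"
    by (simp add: int_pow_pow flip: int_pow_int)
  also have "\<dots> = w [^] (1 :: int)" using h by (subst w_pow_eq_iff) (simp add: mult.commute)
  finally show ?thesis by (simp add: f_sigma)
qed

lemma comm_exp_if_braid_rels:
  assumes rels: "\<And>u v. (u, v) \<in> braid_rels g \<Longrightarrow> word_val G f u = word_val G f v"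
    and ij: "i < 2 * g" "j < 2 * g"
  shows "comm_exp (f (braid_basis g i)) (f (braid_basis g j)) (symp g i j)"
proof -
  have self: "comm_exp x x 0" if "x \<in> carrier G" for x
    using that by (simp add: comm_exp_def)
  have less: "comm_exp (f (C i)) (f (D j)) 0"
    if "C \<in> {BrA, BrB}" "D \<in> {BrA, BrB}" "j < i" "i \<in> {1..g}" "j \<in> {1..g}" for C D i j
  proof -
    have "(wcomm (gen (C i)) (winv (gen BrSigma) @ gen (D j) @ gen BrSigma), []) \<in> braid_rels g"
      using that(1,2) unfolding braid_rels_def Let_def
      by (elim insertE emptyE; hypsubst; use that(3-) in blast)
    then have "word_val G f (wcomm (gen (C i)) (winv (gen BrSigma) @ gen (D j) @ gen BrSigma)) = w [^] (0 :: int)"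
      using rels by fastforce
    moreover have "C i \<in> braid_gens g" "D j \<in> braid_gens g" using that by auto
    ultimately show ?thesis by (simp only: val_commutator_sigma)
  qed
  have neq: "comm_exp (f (C i)) (f (D j)) 0"
    if "C \<in> {BrA, BrB}" "D \<in> {BrA, BrB}" "i \<noteq> j" "i \<in> {1..g}" "j \<in> {1..g}" for C D i j
  proof (cases "j < i")
    case False
    then have "comm_exp (f (D j)) (f (C i)) 0" using that by (intro less) auto
    moreover have "C i \<in> braid_gens g" "D j \<in> braid_gens g" using that by auto
    ultimately show ?thesis using comm_exp_sym[of "f (D j)" "f (C i)" 0] by (simp add: f_closed)
  qed (use that less in auto)
  have dual: "comm_exp (f (BrA i)) (f (BrB i)) 1" if "i \<in> {1..g}" for i
  proof -
    have "(wcomm (gen (BrA i)) (winv (gen BrSigma) @ gen (BrB i) @ winv (gen BrSigma)), wpow 2 (gen BrSigma))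
        \<in> braid_rels g"
      using that unfolding braid_rels_def Let_def by blast
    then have "word_val G f (wcomm (gen (BrA i)) (winv (gen BrSigma) @ gen (BrB i) @ winv (gen BrSigma)))
        = w [^] (1 :: int)"
      using rels val_sigma_square by metis
    then show ?thesis using that by (simp only: val_commutator_sigma braid_gens_simps)
  qed
  have dual': "comm_exp (f (BrB i)) (f (BrA i)) (- 1)" if "i \<in> {1..g}" for i
    using that by (intro comm_exp_sym dual f_closed) simp_all
  show ?thesis
  proof (cases "i < g"; cases "j < g")
    assume "i < g" "j < g"
    then show ?thesis
      by (cases "i = j") (auto simp: braid_basis_def symp_def f_closed intro!: self neq[of BrA BrA])
  next
    assume "\<not> i < g" "\<not> j < g"
    then show ?thesis using ij
      by (cases "i = j") (auto simp: braid_basis_def symp_def f_closed intro!: self neq[of BrB BrB])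
  next
    assume "i < g" "\<not> j < g"
    then show ?thesis using ij
      by (cases "j = i + g") (auto simp: braid_basis_def symp_def intro!: dual neq[of BrA BrB])
  next
    assume "\<not> i < g" "j < g"
    then show ?thesis using ij
      by (cases "i = j + g") (auto simp: braid_basis_def symp_def intro!: dual' neq[of BrB BrA])
  qed
qed

text \<open>
  The only relation that is not about a single commutator is the surface relation. Each factor
  \<open>[a\<^sub>i, b\<^sub>i\<^sup>-\<^sup>1]\<close> has the value \<open>w\<^sup>-\<^sup>1\<close>, so the product is \<open>w\<^sup>-\<^sup>g\<close>, which agrees with \<open>w\<close>
  because \<open>p\<close> divides \<open>g + 1\<close>.
\<close>

lemma braid_rels_if_comm_exp:
  assumes comm: "\<And>i j. i < 2 * g \<Longrightarrow> j < 2 * g \<Longrightarrow>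
      comm_exp (f (braid_basis g i)) (f (braid_basis g j)) (symp g i j)"
    and g: "[int g = - 1] (mod int p)"
    and "(u, v) \<in> braid_rels g"
  shows "word_val G f u = word_val G f v"
proof -
  have AA: "comm_exp (f (BrA i)) (f (BrA j)) 0" if "i \<in> {1..g}" "j \<in> {1..g}" for i j
    using comm[of "i - 1" "j - 1"] that
    by (cases i; cases j) (auto simp: braid_basis_def symp_def split: if_splits)
  have BB: "comm_exp (f (BrB i)) (f (BrB j)) 0" if "i \<in> {1..g}" "j \<in> {1..g}" for i j
    using comm[of "g + (i - 1)" "g + (j - 1)"] that
    by (cases i; cases j) (auto simp: braid_basis_def symp_def split: if_splits)
  have AB: "comm_exp (f (BrA i)) (f (BrB j)) 0" and BA: "comm_exp (f (BrB i)) (f (BrA j)) 0"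
    if "i \<in> {1..g}" "j \<in> {1..g}" "j < i" for i j
    using comm[of "i - 1" "g + (j - 1)"] comm[of "g + (i - 1)" "j - 1"] that
    by (cases i; cases j; auto simp: braid_basis_def symp_def split: if_splits)+
  have dual: "comm_exp (f (BrA i)) (f (BrB i)) 1" if "i \<in> {1..g}" for i
    using comm[of "i - 1" "g + (i - 1)"] that
    by (cases i) (auto simp: braid_basis_def symp_def split: if_splits)
  have one: "word_val G f [] = w [^] (0 :: int)" by simp
  have prod: "word_val G f (concat (map (\<lambda>i. wcomm (gen (BrA i)) (winv (gen (BrB i)))) is))
      = w [^] (- int (length is))" if "set is \<subseteq> {1..g}" for "is"
    using that
  proof (induction "is")
    case Nil
    then show ?case by simp
  next
    case (Cons i "is")
    have i: "i \<in> {1..g}" and "is": "set is \<subseteq> {1..g}" using Cons.prems by auto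
    have "comm_exp (f (BrA i)) (f (BrB i) [^] (- 1 :: int)) (- 1 * 1)"
      using dual[OF i] i by (intro comm_exp_pow_right f_closed) simp_all
    then have "comm_exp (f (BrA i)) (inv f (BrB i)) (- 1)"
      using i by (simp add: int_pow_neg f_closed)
    then have "word_val G f (wcomm (gen (BrA i)) (winv (gen (BrB i)))) = w [^] (- 1 :: int)"
      using i commutator_eq_w_pow_iff[of "f (BrA i)" "inv f (BrB i)" "- 1"] by (simp add: f_closed)
    moreover have "concat (map (\<lambda>i. wcomm (gen (BrA i)) (winv (gen (BrB i)))) is) \<in> words (braid_gens g)"
      using subsetD[OF "is"] by (force intro!: words_concat)
    moreover have "w [^] (- 1 :: int) \<otimes> w [^] (- int (length is)) = w [^] (- 1 + - int (length is))"
      by (rule int_pow_mult[symmetric]) simp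
    ultimately show ?case using Cons.IH[OF "is"] i by simp
  qed
  have wg: "w [^] (- int g) = w [^] (1 :: int)"
    unfolding w_pow_eq_iff using g cong_minus_minus_iff[of "int g" "- 1" "int p"] by simp
  show ?thesis
    using \<open>(u, v) \<in> braid_rels g\<close>
    unfolding braid_rels_def Let_def
    by (elim UnE CollectE exE conjE singletonE Pair_inject; hypsubst)
      (simp_all only: one val_sigma_square val_commutator_sigma braid_gens_simps
        AA BB AB BA dual prod wg set_upt length_upt diff_Suc_1 atLeastLessThanSuc_atLeastAtMost subset_refl)
qed

end


section \<open>Admissible epimorphisms as symplectic frames\<close>

definition braid_tuple :: "nat \<Rightarrow> (braid_gen word set \<Rightarrow> 'a) \<Rightarrow> nat \<Rightarrow> 'a"
  where "braid_tuple g \<phi> i =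
    \<phi> (word_class (braid_gens g) (braid_rels g) (gen (braid_basis g i)))"

lemma braid_gens_eq: "braid_gens g = insert BrSigma (braid_basis g ` {..<2 * g})"
proof
  show "braid_gens g \<subseteq> insert BrSigma (braid_basis g ` {..<2 * g})"
  proof
    fix x assume "x \<in> braid_gens g"
    then consider i where "x = BrA i" "i \<in> {1..g}" | i where "x = BrB i" "i \<in> {1..g}" | "x = BrSigma"
      by (auto simp: braid_gens_def)
    then show "x \<in> insert BrSigma (braid_basis g ` {..<2 * g})"
    proof cases
      case (1 i)
      then have "x = braid_basis g (i - 1)" "i - 1 < 2 * g" by (auto simp: braid_basis_def)
      then show ?thesis by blast
    next
      case (2 i)
      then have "x = braid_basis g (g + (i - 1))" "g + (i - 1) < 2 * g" by (auto simp: braid_basis_def)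
      then show ?thesis by blast
    qed simp
  qed
qed (auto simp: braid_basis_in_gens)

context extra_special_group
begin

text \<open>
  One relation exhibits \<open>s\<^sup>2\<close> as a commutator, hence as a central element, and the order of \<open>s\<close> is odd;
  so \<open>s\<close> is central and equal to \<open>w [^] half\<close> for \<open>w = s\<^sup>2\<close>. The remaining relations then become the
  commutator conditions of a frame.
\<close>

lemma admissible_epi_frame:
  assumes "\<phi> \<in> admissible_epis g G"
  shows "\<phi> (sigma g) \<in> center G"
    and "\<exists>c\<in>{..<2 * g} \<rightarrow>\<^sub>E {0..<int p}.
      symplectic_frame G (\<phi> (sigma g) [^] (2 :: nat)) p g (braid_tuple g \<phi>) c"
proof -
  have hom: "\<phi> \<in> hom (presented_group (braid_gens g) (braid_rels g)) G"
    using assms by (simp add: admissible_epis_def epi_def B2_def)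
  define f where "f = (\<lambda>x. \<phi> (word_class (braid_gens g) (braid_rels g) (gen x)))"
  define s where "s = \<phi> (sigma g)"
  interpret V: group_valuation G "braid_gens g" f
    unfolding f_def by (rule presented_hom_word_val(1)[OF group_axioms hom])
  have rels: "word_val G f u = word_val G f v" if "(u, v) \<in> braid_rels g" for u v
    unfolding f_def
    by (rule presented_hom_word_val(3)[OF group_axioms hom that braid_rels_words[OF that]])
  have s: "f BrSigma = s" by (simp add: f_def s_def sigma_def)
  have s_closed [simp]: "s \<in> carrier G" using V.f_closed[of BrSigma] s by simp
  have "s \<noteq> \<one>"
    using assms ord_eq_1[of \<one>] by (auto simp: admissible_epis_def s_def)
  have "s [^] (2 :: nat) \<in> center G"
  proof -
    define a where "a = f (BrA 1)"
    define b where "b = inv s \<otimes> (f (BrB 1) \<otimes> inv s)"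
    have A: "BrA 1 \<in> braid_gens g" "BrB 1 \<in> braid_gens g" using g_pos by auto
    have ab: "a \<in> carrier G" "b \<in> carrier G"
      using A by (simp_all add: a_def b_def V.f_closed)
    have "(wcomm (gen (BrA 1)) (winv (gen BrSigma) @ gen (BrB 1) @ winv (gen BrSigma)), wpow 2 (gen BrSigma))
        \<in> braid_rels g"
    proof -
      have "1 \<in> {1..g}" using g_pos by simp
      then show ?thesis unfolding braid_rels_def Let_def by blast
    qed
    from rels[OF this] have "a \<otimes> b \<otimes> inv a \<otimes> inv b = s [^] (2 :: nat)"
      using A by (simp add: a_def b_def s)
    then have "a \<otimes> b = s [^] (2 :: nat) \<otimes> (b \<otimes> a)"
      using ab by (simp add: commutator_eq_iff)
    moreover obtain z where "z \<in> center G" "a \<otimes> b = z \<otimes> (b \<otimes> a)"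
      using ab by (rule mult_mod_center)
    ultimately have "s [^] (2 :: nat) = z" using ab by simp
    with \<open>z \<in> center G\<close> show ?thesis by simp
  qed
  then have s_center: "s \<in> center G" by (rule square_central_imp_central[rotated]) simp
  then show "\<phi> (sigma g) \<in> center G" by (simp add: s_def)
  interpret S: central_prime_element G s p
    using s_center \<open>s \<noteq> \<one>\<close> by (rule central_prime_element)
  define w where "w = s [^] (2 :: nat)"
  have w: "w = s [^] (2 :: int)" by (simp add: w_def flip: int_pow_int)
  have "\<not> p dvd 2"
  proof
    assume "p dvd 2"
    then have "p \<le> 2" by (simp add: dvd_imp_le)
    with prime_ge_2_nat[OF prime_p] have "p = 2" by simp
    with odd_p show False by simp
  qed
  then have "w \<noteq> \<one>" by (simp add: w S.w_pow_eq_one_iff flip: int_dvd_int_iff)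
  have w_center: "w \<in> center G"
    using \<open>s [^] (2 :: nat) \<in> center G\<close> by (simp add: w_def)
  have sw: "s = w [^] (int half)"
  proof -
    have "w [^] (int half) = s [^] (int (2 * half))" by (simp add: w int_pow_pow)
    also have "\<dots> = s [^] p \<otimes> s" by (simp add: two_half int_pow_int del: of_nat_add of_nat_Suc)
    finally show ?thesis by (simp add: S.w_pow_p)
  qed
  interpret W: central_prime_element G w p
    using w_center \<open>w \<noteq> \<one>\<close> by (rule central_prime_element)
  interpret B: braid_valuation G w p g f "int half"
  proof unfold_locales
    show "f BrSigma = w [^] (int half)" using s sw by simp
    have "2 * int half = int p + 1" using two_half by linarith
    then show "[2 * int half = 1] (mod int p)" by (simp add: cong_def)
  qed
  have tuple: "braid_tuple g \<phi> i = f (braid_basis g i)" for i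
    by (simp add: braid_tuple_def f_def)
  obtain c where "c \<in> {..<2 * g} \<rightarrow>\<^sub>E {0..<int p}"
      "symplectic_frame G w p g (braid_tuple g \<phi>) c"
  proof (rule frameI[OF w_center \<open>w \<noteq> \<one>\<close>])
    show "braid_tuple g \<phi> i \<in> carrier G" if "i < 2 * g" for i
      unfolding tuple using that by (intro V.f_closed braid_basis_in_gens)
    show "W.comm_exp (braid_tuple g \<phi> i) (braid_tuple g \<phi> j) (symp g i j)"
      if "i < 2 * g" "j < 2 * g" for i j
      unfolding tuple using that rels by (intro B.comm_exp_if_braid_rels)
  qed
  then show "\<exists>c\<in>{..<2 * g} \<rightarrow>\<^sub>E {0..<int p}.
      symplectic_frame G (\<phi> (sigma g) [^] (2 :: nat)) p g (braid_tuple g \<phi>) c"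
    unfolding w_def s_def by blast
qed

text \<open>
  The value of \<open>\<sigma>\<close> has to be the square root of \<open>w\<close> in the centre. The homomorphism defined by the frame
  is onto because a frame generates \<open>G\<close>.
\<close>

lemma frame_admissible_epi:
  assumes "symplectic_frame G w p g t c" and g: "[int g = - 1] (mod int p)"
  shows "\<exists>\<phi>\<in>admissible_epis g G. \<phi> (sigma g) [^] (2 :: nat) = w \<and>
    (\<forall>i<2 * g. braid_tuple g \<phi> i = t i)"
proof -
  interpret F: symplectic_frame G w p g t c by fact
  define s where "s = w [^] (int half)"
  define f where "f x = (case x of BrA i \<Rightarrow> t (i - 1) | BrB i \<Rightarrow> t (g + (i - 1)) | BrSigma \<Rightarrow> s)" for x
  have basis: "f (braid_basis g i) = t i" if "i < 2 * g" for i
    using that by (auto simp: f_def braid_basis_def)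
  have f_closed: "f x \<in> carrier G" if "x \<in> braid_gens g" for x
    using that unfolding braid_gens_eq by (auto simp: basis F.t_closed) (simp add: f_def s_def)
  interpret B: braid_valuation G w p g f "int half"
  proof unfold_locales
    show "f BrSigma = w [^] (int half)" by (simp add: f_def s_def)
    have "2 * int half = int p + 1" using two_half by linarith
    then show "[2 * int half = 1] (mod int p)" by (simp add: cong_def)
  qed (rule f_closed)
  have rels: "word_val G f u = word_val G f v" if "(u, v) \<in> braid_rels g" for u v
    using that by (intro B.braid_rels_if_comm_exp[OF _ g]) (simp_all add: basis F.t_comm_exp)
  obtain \<phi> where hom: "\<phi> \<in> hom (presented_group (braid_gens g) (braid_rels g)) G"
    and ext: "\<phi> \<in> extensional (carrier (presented_group (braid_gens g) (braid_rels g)))"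
    and val: "\<And>u. u \<in> words (braid_gens g) \<Longrightarrow>
      \<phi> (word_class (braid_gens g) (braid_rels g) u) = word_val G f u"
    using B.exists_presented_hom[of "braid_rels g", OF rels] by blast
  have tuple: "braid_tuple g \<phi> i = t i" if "i < 2 * g" for i
    using that by (simp add: braid_tuple_def val basis braid_basis_in_gens)
  have sigma: "\<phi> (sigma g) = s" by (simp add: sigma_def val f_def)
  have square: "s [^] (2 :: nat) = w"
  proof -
    have "s [^] (2 :: nat) = w [^] (int (2 * half))"
      by (simp add: s_def int_pow_pow mult.commute flip: int_pow_int)
    also have "\<dots> = w [^] p \<otimes> w" by (simp add: two_half int_pow_int del: of_nat_add of_nat_Suc)
    finally show ?thesis by (simp add: F.w_pow_p)
  qed
  have "\<phi> \<in> epi (B2 g) G"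
  proof -
    interpret B2: group "B2 g" unfolding B2_def by (rule group_presented_group)
    interpret P: group_hom "B2 g" G \<phi>
      using hom by unfold_locales (simp add: B2_def)
    have mem: "\<phi> (word_class (braid_gens g) (braid_rels g) (gen x)) \<in> \<phi> ` carrier (B2 g)"
      if "x \<in> braid_gens g" for x
      using that by (auto simp: B2_def carrier_presented_group)
    have "subgroup (\<phi> ` carrier (B2 g)) G" by (rule P.img_is_subgroup)
    moreover have "w \<in> \<phi> ` carrier (B2 g)"
    proof -
      have "s \<in> \<phi> ` carrier (B2 g)" using mem[of BrSigma] sigma by (simp add: sigma_def)
      then show ?thesis
        using subgroup_int_pow_closed[OF P.img_is_subgroup, of s 2] square
        by (simp flip: int_pow_int)
    qed
    moreover have "t i \<in> \<phi> ` carrier (B2 g)" if "i < 2 * g" for i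
      using mem[OF braid_basis_in_gens[OF that]] tuple[OF that] by (simp add: braid_tuple_def)
    ultimately have "\<phi> ` carrier (B2 g) = carrier G"
      by (rule F.subgroup_containing_frame)
    then show ?thesis using hom by (simp add: epi_def B2_def)
  qed
  moreover have "2 \<le> ord s"
  proof -
    have "s \<in> carrier G" by (simp add: s_def)
    moreover have "s \<noteq> \<one>" using square F.w_neq_one by auto
    ultimately show ?thesis
      using ord_eq_1[of s] ord_ge_1[OF F.finite_carrier, of s] by fastforce
  qed
  ultimately have "\<phi> \<in> admissible_epis g G"
    using ext by (simp add: admissible_epis_def sigma B2_def)
  moreover have "\<phi> (sigma g) [^] (2 :: nat) = w" unfolding sigma by (rule square)
  ultimately show ?thesis using tuple by blast
qed

text \<open>
  The frame of an epimorphism records the square of the value on \<open>\<sigma>\<close>. The value itself is central of odd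
  order, hence determined by its square.
\<close>

lemma admissible_epi_eq_compose:
  assumes "\<phi> \<in> admissible_epis g G" "\<psi> \<in> admissible_epis g G" "\<alpha> \<in> auto G"
    and w: "\<alpha> (\<phi> (sigma g) [^] (2 :: nat)) = \<psi> (sigma g) [^] (2 :: nat)"
    and t: "\<And>i. i < 2 * g \<Longrightarrow> \<alpha> (braid_tuple g \<phi> i) = braid_tuple g \<psi> i"
  shows "\<psi> = compose (carrier (B2 g)) \<alpha> \<phi>"
proof -
  have hom: "\<phi> \<in> hom (B2 g) G" "\<psi> \<in> hom (B2 g) G" and ext: "\<psi> \<in> extensional (carrier (B2 g))"
    using assms(1,2) by (simp_all add: admissible_epis_def epi_def)
  have \<alpha>: "\<alpha> \<in> hom G G" using assms(3) by (simp add: auto_def)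
  interpret \<alpha>: group_hom G G \<alpha> using \<alpha> by unfold_locales
  interpret B2: group "B2 g" unfolding B2_def by (rule group_presented_group)
  have root: "(s [^] (2 :: nat)) [^] half = s" if "s \<in> center G" for s
  proof (cases "s = \<one>")
    case False
    interpret S: central_prime_element G s p using that False by (rule central_prime_element)
    have "(s [^] (2 :: nat)) [^] half = s [^] p \<otimes> s"
      by (simp add: nat_pow_pow two_half)
    then show ?thesis by (simp add: S.w_pow_p)
  qed simp
  have c: "\<phi> (sigma g) \<in> center G" "\<psi> (sigma g) \<in> center G"
    using assms(1,2) by (simp_all add: admissible_epi_frame(1))
  have \<sigma>: "\<alpha> (\<phi> (sigma g)) = \<psi> (sigma g)"
  proof -
    have "\<alpha> (\<phi> (sigma g)) = \<alpha> ((\<phi> (sigma g) [^] (2 :: nat)) [^] half)"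
      by (simp only: root[OF c(1)])
    also have "\<dots> = \<alpha> (\<phi> (sigma g) [^] (2 :: nat)) [^] half"
      using c(1) by (intro \<alpha>.hom_nat_pow nat_pow_closed center_closed)
    also have "\<dots> = \<psi> (sigma g)" by (simp only: w root[OF c(2)])
    finally show ?thesis .
  qed
  have comp: "compose (carrier (B2 g)) \<alpha> \<phi> \<in> hom (B2 g) G"
    using hom(1) \<alpha> by (rule B2.hom_compose)
  have class_closed: "word_class (braid_gens g) (braid_rels g) (gen x) \<in> carrier (B2 g)"
    if "x \<in> braid_gens g" for x
    using that by (auto simp: B2_def carrier_presented_group)
  show ?thesis
  proof (rule presented_hom_ext[OF group_axioms, of _ "braid_gens g" "braid_rels g"])
    fix x assume x: "x \<in> braid_gens g"
    then consider "x = BrSigma" | i where "i < 2 * g" "x = braid_basis g i"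
      by (auto simp: braid_gens_eq)
    then have "\<alpha> (\<phi> (word_class (braid_gens g) (braid_rels g) (gen x)))
        = \<psi> (word_class (braid_gens g) (braid_rels g) (gen x))"
    proof cases
      case 1
      then show ?thesis using \<sigma> by (simp add: sigma_def)
    next
      case (2 i)
      then show ?thesis using t by (simp add: braid_tuple_def)
    qed
    then show "\<psi> (word_class (braid_gens g) (braid_rels g) (gen x))
        = compose (carrier (B2 g)) \<alpha> \<phi> (word_class (braid_gens g) (braid_rels g) (gen x))"
      using class_closed[OF x] by (simp add: compose_eq)
  qed (use hom comp ext in \<open>simp_all add: B2_def\<close>)
qed

end


section \<open>Orbits of admissible epimorphisms\<close>

lemma card_image_eq_if_same_fibres:
  assumes "\<And>x y. x \<in> E \<Longrightarrow> y \<in> E \<Longrightarrow> f x = f y \<longleftrightarrow> h x = h y"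
  shows "card (f ` E) = card (h ` E)"
proof (rule bij_betw_same_card)
  have inv: "inv_into E f (f x) \<in> E" "f (inv_into E f (f x)) = f x" if "x \<in> E" for x
    using that by (auto intro: inv_into_into f_inv_into_f)
  have "h (inv_into E f (f x)) = h x" if "x \<in> E" for x
    using assms[OF inv(1)[OF that] that] inv(2)[OF that] by simp
  then show "bij_betw (\<lambda>y. h (inv_into E f y)) (f ` E) (h ` E)"
    using assms by (auto simp: bij_betw_def inj_on_def image_image)
qed

context extra_special_group
begin

text \<open>
  The vectors are normalised to have entries in \<open>{0..<p}\<close> and to be undefined beyond \<open>2 * g\<close>, so that
  each vector of residues is counted once.
\<close>

definition power_vectors :: "(nat \<Rightarrow> int) set"
  where "power_vectors =
    {c \<in> {..<2 * g} \<rightarrow>\<^sub>E {0..<int p}. \<exists>w t. symplectic_frame G w p g t c}"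

lemma frame_power_unique:
  assumes "symplectic_frame G w p g t c" "symplectic_frame G w p g t d"
    and "c \<in> {..<2 * g} \<rightarrow>\<^sub>E {0..<int p}" "d \<in> {..<2 * g} \<rightarrow>\<^sub>E {0..<int p}"
  shows "c = d"
proof (rule PiE_ext[OF assms(3,4)])
  fix i assume i: "i \<in> {..<2 * g}"
  interpret C: symplectic_frame G w p g t c by fact
  have i': "i < 2 * g" using i by simp
  have "w [^] c i = w [^] d i"
    using C.t_pow_p[OF i'] symplectic_frame.t_pow_p[OF assms(2) i'] by simp
  then have "[c i = d i] (mod int p)" by (simp only: C.w_pow_eq_iff)
  moreover have "c i \<in> {0..<int p}" "d i \<in> {0..<int p}"
    using PiE_mem[OF assms(3) i] PiE_mem[OF assms(4) i] by simp_all
  ultimately show "c i = d i" by (simp add: cong_def)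
qed

definition power_vector :: "(braid_gen word set \<Rightarrow> 'a) \<Rightarrow> nat \<Rightarrow> int"
  where "power_vector \<phi> = (SOME c. c \<in> {..<2 * g} \<rightarrow>\<^sub>E {0..<int p} \<and>
    symplectic_frame G (\<phi> (sigma g) [^] (2 :: nat)) p g (braid_tuple g \<phi>) c)"

lemma power_vector:
  assumes "\<phi> \<in> admissible_epis g G"
  shows "power_vector \<phi> \<in> {..<2 * g} \<rightarrow>\<^sub>E {0..<int p}"
    and "symplectic_frame G (\<phi> (sigma g) [^] (2 :: nat)) p g (braid_tuple g \<phi>) (power_vector \<phi>)"
proof -
  have "\<exists>c. c \<in> {..<2 * g} \<rightarrow>\<^sub>E {0..<int p} \<and>
      symplectic_frame G (\<phi> (sigma g) [^] (2 :: nat)) p g (braid_tuple g \<phi>) c"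
    using admissible_epi_frame(2)[OF assms] by blast
  from someI_ex[OF this, folded power_vector_def]
  show "power_vector \<phi> \<in> {..<2 * g} \<rightarrow>\<^sub>E {0..<int p}"
    and "symplectic_frame G (\<phi> (sigma g) [^] (2 :: nat)) p g (braid_tuple g \<phi>) (power_vector \<phi>)"
    by blast+
qed

lemma power_vector_eqI:
  assumes "\<phi> \<in> admissible_epis g G" "c \<in> {..<2 * g} \<rightarrow>\<^sub>E {0..<int p}"
    and "symplectic_frame G (\<phi> (sigma g) [^] (2 :: nat)) p g (braid_tuple g \<phi>) c"
  shows "power_vector \<phi> = c"
  by (rule frame_power_unique[OF power_vector(2)[OF assms(1)] assms(3) power_vector(1)[OF assms(1)] assms(2)])

lemma power_vector_compose:
  assumes \<phi>: "\<phi> \<in> admissible_epis g G" and \<alpha>: "\<alpha> \<in> auto G"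
    and \<psi>: "compose (carrier (B2 g)) \<alpha> \<phi> \<in> admissible_epis g G" (is "?\<psi> \<in> _")
  shows "power_vector ?\<psi> = power_vector \<phi>"
proof (rule power_vector_eqI[OF \<psi> power_vector(1)[OF \<phi>]])
  interpret \<alpha>: group_hom G G \<alpha> using \<alpha> by unfold_locales (simp add: auto_def)
  interpret F: symplectic_frame G "\<phi> (sigma g) [^] (2 :: nat)" p g "braid_tuple g \<phi>" "power_vector \<phi>"
    by (rule power_vector(2)[OF \<phi>])
  interpret F': symplectic_frame G "?\<psi> (sigma g) [^] (2 :: nat)" p g "braid_tuple g ?\<psi>" "power_vector ?\<psi>"
    by (rule power_vector(2)[OF \<psi>])
  have class_closed: "word_class (braid_gens g) (braid_rels g) (gen x) \<in> carrier (B2 g)"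
    if "x \<in> braid_gens g" for x
    using that by (auto simp: B2_def carrier_presented_group)
  have \<sigma>: "?\<psi> (sigma g) = \<alpha> (\<phi> (sigma g))"
    unfolding sigma_def by (rule compose_eq) (rule class_closed, simp)
  have t: "braid_tuple g ?\<psi> i = \<alpha> (braid_tuple g \<phi> i)" if "i < 2 * g" for i
    unfolding braid_tuple_def by (rule compose_eq) (rule class_closed[OF braid_basis_in_gens[OF that]])
  have \<sigma>_closed: "\<phi> (sigma g) \<in> carrier G"
    using admissible_epi_frame(1)[OF \<phi>] by simp
  have w: "?\<psi> (sigma g) [^] (2 :: nat) = \<alpha> (\<phi> (sigma g) [^] (2 :: nat))"
    unfolding \<sigma> using \<sigma>_closed by (rule \<alpha>.hom_nat_pow[symmetric])
  have pow: "braid_tuple g ?\<psi> i [^] p = (?\<psi> (sigma g) [^] (2 :: nat)) [^] power_vector \<phi> i"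
    if i: "i < 2 * g" for i
  proof -
    have "braid_tuple g ?\<psi> i [^] p = \<alpha> (braid_tuple g \<phi> i [^] p)"
      unfolding t[OF i] using F.t_closed[OF i] by (rule \<alpha>.hom_nat_pow[symmetric])
    also have "\<dots> = \<alpha> ((\<phi> (sigma g) [^] (2 :: nat)) [^] power_vector \<phi> i)"
      by (simp only: F.t_pow_p[OF i])
    also have "\<dots> = (?\<psi> (sigma g) [^] (2 :: nat)) [^] power_vector \<phi> i"
      unfolding w using F.w_closed by (rule \<alpha>.hom_int_pow)
    finally show ?thesis .
  qed
  show "symplectic_frame G (?\<psi> (sigma g) [^] (2 :: nat)) p g (braid_tuple g ?\<psi>) (power_vector \<phi>)"
    by unfold_locales (fact F'.t_closed F'.t_comm_exp F'.order_G pow)+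
qed

lemma exists_auto_compose:
  assumes "\<phi> \<in> admissible_epis g G" "\<psi> \<in> admissible_epis g G"
    and "power_vector \<phi> = power_vector \<psi>"
  obtains \<alpha> where "\<alpha> \<in> auto G" "\<psi> = compose (carrier (B2 g)) \<alpha> \<phi>"
proof -
  note F = power_vector(2)[OF assms(1)] power_vector(2)[OF assms(2), folded assms(3)]
  obtain \<alpha> where \<alpha>: "\<alpha> \<in> auto G"
      "\<alpha> (\<phi> (sigma g) [^] (2 :: nat)) = \<psi> (sigma g) [^] (2 :: nat)"
      "\<And>i. i < 2 * g \<Longrightarrow> \<alpha> (braid_tuple g \<phi> i) = braid_tuple g \<psi> i"
    using exists_automorphism[OF F] by blast
  then have "\<psi> = compose (carrier (B2 g)) \<alpha> \<phi>"
    by (intro admissible_epi_eq_compose[OF assms(1,2)])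
  with \<alpha>(1) show thesis by (rule that)
qed

abbreviation aut_orbit :: "(braid_gen word set \<Rightarrow> 'a) \<Rightarrow> (braid_gen word set \<Rightarrow> 'a) set"
  where "aut_orbit \<equiv> orbit (AutoGroup G) (\<lambda>\<alpha> \<phi>. compose (carrier (B2 g)) \<alpha> \<phi>)"

lemma aut_orbit_eq: "aut_orbit \<phi> = (\<lambda>\<alpha>. compose (carrier (B2 g)) \<alpha> \<phi>) ` auto G"
  by (auto simp: orbit_def AutoGroup_def)

lemma aut_orbit_mono:
  assumes \<phi>: "\<phi> \<in> admissible_epis g G" and \<psi>: "\<psi> \<in> admissible_epis g G"
    and eq: "power_vector \<phi> = power_vector \<psi>"
  shows "aut_orbit \<psi> \<subseteq> aut_orbit \<phi>"
proof
  obtain \<alpha> where \<alpha>: "\<alpha> \<in> auto G" "\<psi> = compose (carrier (B2 g)) \<alpha> \<phi>"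
    using assms by (rule exists_auto_compose)
  fix \<chi> assume "\<chi> \<in> aut_orbit \<psi>"
  then obtain \<beta> where \<beta>: "\<beta> \<in> auto G" "\<chi> = compose (carrier (B2 g)) \<beta> \<psi>"
    unfolding aut_orbit_eq by blast
  have "\<phi> \<in> carrier (B2 g) \<rightarrow> carrier G"
    using \<phi> by (auto simp: admissible_epis_def epi_def hom_def)
  then have "\<chi> = compose (carrier (B2 g)) (compose (carrier G) \<beta> \<alpha>) \<phi>"
    unfolding \<alpha>(2) \<beta>(2) by (rule compose_assoc)
  moreover have "compose (carrier G) \<beta> \<alpha> \<in> auto G"
    using \<alpha>(1) \<beta>(1) hom_compose[of \<alpha> G \<beta> G] compose_Bij[of \<beta> _ \<alpha>] by (simp add: auto_def)
  ultimately show "\<chi> \<in> aut_orbit \<phi>"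
    unfolding aut_orbit_eq by (rule image_eqI)
qed

lemma aut_orbit_eq_iff:
  assumes \<phi>: "\<phi> \<in> admissible_epis g G" and \<psi>: "\<psi> \<in> admissible_epis g G"
  shows "aut_orbit \<phi> = aut_orbit \<psi> \<longleftrightarrow> power_vector \<phi> = power_vector \<psi>"
proof
  assume "aut_orbit \<phi> = aut_orbit \<psi>"
  moreover have "\<psi> \<in> aut_orbit \<psi>"
    using exists_auto_compose[OF \<psi> \<psi> refl] unfolding aut_orbit_eq by blast
  ultimately obtain \<alpha> where \<alpha>: "\<alpha> \<in> auto G" "\<psi> = compose (carrier (B2 g)) \<alpha> \<phi>"
    unfolding aut_orbit_eq by blast
  show "power_vector \<phi> = power_vector \<psi>"
    using power_vector_compose[OF \<phi> \<alpha>(1)] \<psi> unfolding \<alpha>(2) by simp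
next
  assume eq: "power_vector \<phi> = power_vector \<psi>"
  show "aut_orbit \<phi> = aut_orbit \<psi>"
    by (rule subset_antisym[OF aut_orbit_mono[OF \<psi> \<phi> eq[symmetric]] aut_orbit_mono[OF \<phi> \<psi> eq]])
qed

lemma N_circ_eq_card_power_vectors:
  assumes g: "[int g = - 1] (mod int p)"
  shows "N_circ g G = card power_vectors"
proof -
  have "N_circ g G = card (aut_orbit ` admissible_epis g G)"
    unfolding N_circ_def orbits_def by (rule arg_cong[of _ _ card]) blast
  also have "\<dots> = card (power_vector ` admissible_epis g G)"
    by (rule card_image_eq_if_same_fibres) (rule aut_orbit_eq_iff)
  also have "power_vector ` admissible_epis g G = power_vectors"
  proof
    show "power_vector ` admissible_epis g G \<subseteq> power_vectors"
    proof clarify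
      fix \<phi> assume "\<phi> \<in> admissible_epis g G"
      from power_vector[OF this] show "power_vector \<phi> \<in> power_vectors"
        unfolding power_vectors_def by blast
    qed
    show "power_vectors \<subseteq> power_vector ` admissible_epis g G"
    proof
      fix c assume "c \<in> power_vectors"
      then obtain w t where c: "c \<in> {..<2 * g} \<rightarrow>\<^sub>E {0..<int p}" and F: "symplectic_frame G w p g t c"
        unfolding power_vectors_def by blast
      interpret F: symplectic_frame G w p g t c by (rule F)
      obtain \<phi> where \<phi>: "\<phi> \<in> admissible_epis g G" "\<phi> (sigma g) [^] (2 :: nat) = w"
          "\<And>i. i < 2 * g \<Longrightarrow> braid_tuple g \<phi> i = t i"
        using frame_admissible_epi[OF F g] by blast
      have "symplectic_frame G w p g (braid_tuple g \<phi>) c"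
        by unfold_locales (simp_all only: \<phi>(3) F.t_closed F.t_comm_exp F.t_pow_p F.order_G)
      then have "power_vector \<phi> = c"
        by (intro power_vector_eqI[OF \<phi>(1) c]) (simp only: \<phi>(2))
      with \<phi>(1) show "c \<in> power_vector ` admissible_epis g G" by blast
    qed
  qed
  finally show ?thesis .
qed

end


section \<open>The two presentations\<close>

definition es_basis :: "nat \<Rightarrow> nat \<Rightarrow> es_gen"
  where "es_basis g i = (if i < g then EsX (Suc i) else EsY (Suc (i - g)))"

lemma es_gens_simps [simp]:
  "EsX i \<in> es_gens g \<longleftrightarrow> i \<in> {1..g}"
  "EsY i \<in> es_gens g \<longleftrightarrow> i \<in> {1..g}"
  "EsZ \<in> es_gens g"
  by (auto simp: es_gens_def)

lemma es_basis_in_gens: "i < 2 * g \<Longrightarrow> es_basis g i \<in> es_gens g"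
  by (auto simp: es_basis_def)

context extra_special_group
begin

text \<open>
  The generators form a frame with \<open>w = z\<^sup>-\<^sup>1\<close>. If \<open>z\<close> were trivial, all generators would
  commute and \<open>G\<close> would be abelian, although its centre has only \<open>p\<close> elements.
\<close>

lemma presentation_frame:
  assumes epi: "\<phi> \<in> epi (presented_group (es_gens g) R) G" and R: "es_common_rels p g \<subseteq> R"
  defines "f \<equiv> \<lambda>x. \<phi> (word_class (es_gens g) R (gen x))"
  shows "f EsZ \<noteq> \<one>"
    and "\<exists>c\<in>{..<2 * g} \<rightarrow>\<^sub>E {0..<int p}.
      symplectic_frame G (inv f EsZ) p g (\<lambda>i. f (es_basis g i)) c"
proof -
  have hom: "\<phi> \<in> hom (presented_group (es_gens g) R) G" using epi by (simp add: epi_def)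
  interpret V: group_valuation G "es_gens g" f
    unfolding f_def by (rule presented_hom_word_val(1)[OF group_axioms hom])
  have rels: "word_val G f u = word_val G f v"
    if "(u, v) \<in> es_common_rels p g" "u \<in> words (es_gens g)" "v \<in> words (es_gens g)" for u v
    unfolding f_def using that R by (intro presented_hom_word_val(3)[OF group_axioms hom]) auto
  have f_closed: "f x \<in> carrier G" if "x \<in> es_gens g" for x using that by (rule V.f_closed)
  have gens: "es_gens g = EsX ` {1..g} \<union> EsY ` {1..g} \<union> {EsZ}" by (rule es_gens_def)
  have comm: "f x \<otimes> f y = word_val G f v \<otimes> (f y \<otimes> f x)"
    if "(wcomm (gen x) (gen y), v) \<in> es_common_rels p g" "x \<in> es_gens g" "y \<in> es_gens g"
      "v \<in> words (es_gens g)" for x y v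
    using rels[OF that(1)] that(2-) by (simp add: f_closed commutator_eq_iff)
  have comm1: "f x \<otimes> f y = f y \<otimes> f x"
    if "(wcomm (gen x) (gen y), []) \<in> es_common_rels p g" "x \<in> es_gens g" "y \<in> es_gens g" for x y
    using comm[OF that] that(2,3) by (simp add: f_closed)
  have XZ: "f (EsX i) \<otimes> f EsZ = f EsZ \<otimes> f (EsX i)" if "i \<in> {1..g}" for i
    using that by (intro comm1) (auto simp: es_common_rels_def Let_def)
  have YZ: "f (EsY i) \<otimes> f EsZ = f EsZ \<otimes> f (EsY i)" if "i \<in> {1..g}" for i
    using that by (intro comm1) (auto simp: es_common_rels_def Let_def)
  have XX: "f (EsX i) \<otimes> f (EsX j) = f (EsX j) \<otimes> f (EsX i)" if "i \<in> {1..g}" "j \<in> {1..g}" for i j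
    using that unfolding es_common_rels_def Let_def by (intro comm1; simp add: es_common_rels_def Let_def; blast)
  have YY: "f (EsY i) \<otimes> f (EsY j) = f (EsY j) \<otimes> f (EsY i)" if "i \<in> {1..g}" "j \<in> {1..g}" for i j
    using that unfolding es_common_rels_def Let_def by (intro comm1; simp add: es_common_rels_def Let_def; blast)
  have XY: "f (EsX i) \<otimes> f (EsY j) = (if i = j then inv f EsZ else \<one>) \<otimes> (f (EsY j) \<otimes> f (EsX i))"
    if "i \<in> {1..g}" "j \<in> {1..g}" for i j
  proof -
    have "(wcomm (gen (EsX i)) (gen (EsY j)), if i = j then winv (gen EsZ) else []) \<in> es_common_rels p g"
      using that unfolding es_common_rels_def Let_def by blast
    from comm[OF this] show ?thesis using that by (cases "i = j") simp_all
  qed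
  have generate: "K = carrier G" if "subgroup K G" "\<And>x. x \<in> es_gens g \<Longrightarrow> f x \<in> K" for K
    using presented_epi_subgroup[OF group_axioms epi that(1)] that(2) by (simp add: f_def)
  have z_closed: "f EsZ \<in> carrier G" by (intro f_closed) simp
  have center_if: "f x \<in> center G"
    if x: "x \<in> es_gens g" and c: "\<And>y. y \<in> es_gens g \<Longrightarrow> f y \<otimes> f x = f x \<otimes> f y" for x
  proof -
    have "{y \<in> carrier G. y \<otimes> f x = f x \<otimes> y} = carrier G"
      using c by (intro generate subgroup_centralizer f_closed x) (simp add: f_closed)
    then have "y \<otimes> f x = f x \<otimes> y" if "y \<in> carrier G" for y using that by blast
    then show ?thesis unfolding center_def using f_closed[OF x] by fastforce
  qed
  have z_center: "f EsZ \<in> center G"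
    by (rule center_if) (auto simp: gens XZ YZ)
  show "f EsZ \<noteq> \<one>"
  proof
    assume z: "f EsZ = \<one>"
    have XY1: "f (EsX i) \<otimes> f (EsY j) = f (EsY j) \<otimes> f (EsX i)" if "i \<in> {1..g}" "j \<in> {1..g}" for i j
      using XY[OF that] that by (simp add: z f_closed split: if_splits)
    have "f y \<otimes> f x = f x \<otimes> f y" if "x \<in> es_gens g" "y \<in> es_gens g" for x y
      using that unfolding gens by (auto simp: XX YY XZ YZ XY1 z f_closed)
    then have "f x \<in> center G" if "x \<in> es_gens g" for x
      using that by (intro center_if)
    then have "center G = carrier G"
      by (rule generate[OF subgroup_center])
    with not_abelian show False by blast
  qed
  then have w: "inv f EsZ \<in> center G" "inv f EsZ \<noteq> \<one>"
    using z_center subgroup_center by (auto intro: subgroup.m_inv_closed simp: z_closed inv_eq_1_iff)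
  interpret W: central_prime_element G "inv f EsZ" p using w by (rule central_prime_element)
  have comm0: "W.comm_exp x y 0" if "x \<otimes> y = y \<otimes> x" "x \<in> carrier G" "y \<in> carrier G" for x y
    using that by (simp add: W.comm_exp_def)
  have dual: "W.comm_exp (f (EsX i)) (f (EsY i)) 1" if "i \<in> {1..g}" for i
    using XY[OF that that] z_closed by (simp add: W.comm_exp_def)
  have dual': "W.comm_exp (f (EsY i)) (f (EsX i)) (- 1)" if "i \<in> {1..g}" for i
    using that by (intro W.comm_exp_sym dual f_closed) simp_all
  have XY0: "f (EsX i) \<otimes> f (EsY j) = f (EsY j) \<otimes> f (EsX i)"
    if "i \<in> {1..g}" "j \<in> {1..g}" "i \<noteq> j" for i j
    using XY[of i j] that by (simp add: f_closed)
  have frame_comm: "W.comm_exp (f (es_basis g i)) (f (es_basis g j)) (symp g i j)"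
    if ij: "i < 2 * g" "j < 2 * g" for i j
  proof (cases "i < g"; cases "j < g")
    assume "i < g" "j < g"
    then show ?thesis
      by (auto simp: es_basis_def symp_def f_closed intro!: comm0 XX)
  next
    assume "\<not> i < g" "\<not> j < g"
    then show ?thesis using ij
      by (auto simp: es_basis_def symp_def f_closed intro!: comm0 YY)
  next
    assume "i < g" "\<not> j < g"
    then show ?thesis using ij
      by (cases "j = i + g") (auto simp: es_basis_def symp_def f_closed intro!: dual comm0 XY0)
  next
    assume "\<not> i < g" "j < g"
    then show ?thesis using ij
      by (cases "i = j + g") (auto simp: es_basis_def symp_def f_closed intro!: dual' comm0 XY0[symmetric])
  qed
  obtain c where "c \<in> {..<2 * g} \<rightarrow>\<^sub>E {0..<int p}"
      "symplectic_frame G (inv f EsZ) p g (\<lambda>i. f (es_basis g i)) c"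
  proof (rule frameI[OF w, where t = "\<lambda>i. f (es_basis g i)"])
    show "f (es_basis g i) \<in> carrier G" if "i < 2 * g" for i
      using that by (intro f_closed es_basis_in_gens)
  qed (rule frame_comm)
  then show "\<exists>c\<in>{..<2 * g} \<rightarrow>\<^sub>E {0..<int p}.
      symplectic_frame G (inv f EsZ) p g (\<lambda>i. f (es_basis g i)) c" by blast
qed

lemma zero_vector: "(\<lambda>i\<in>{..<2 * g}. 0) \<in> {..<2 * g} \<rightarrow>\<^sub>E {0..<int p}"
  using prime_gt_0_nat[OF prime_p] by auto

lemma eq_zero_vector:
  assumes "c \<in> {..<2 * g} \<rightarrow>\<^sub>E {0..<int p}" "\<And>i. i < 2 * g \<Longrightarrow> int p dvd c i"
  shows "c = (\<lambda>i\<in>{..<2 * g}. 0)"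
proof (rule PiE_ext[OF assms(1) zero_vector])
  fix i assume i: "i \<in> {..<2 * g}"
  have "int p dvd c i" using i by (intro assms(2)) simp
  moreover have "0 \<le> c i" "c i < int p" using PiE_mem[OF assms(1) i] by simp_all
  ultimately have "c i = 0" by (metis dvd_imp_mod_0 mod_pos_pos_trivial)
  then show "c i = (\<lambda>i\<in>{..<2 * g}. 0) i" using i by simp
qed

lemma power_vectors_exponent_p:
  assumes exp: "\<And>x. x \<in> carrier G \<Longrightarrow> x [^] p = \<one>" and F: "symplectic_frame G w p g t c"
  shows "power_vectors = {\<lambda>i\<in>{..<2 * g}. 0}"
proof
  show "power_vectors \<subseteq> {\<lambda>i\<in>{..<2 * g}. 0}"
  proof
    fix d assume "d \<in> power_vectors"
    then obtain w' t' where d: "d \<in> {..<2 * g} \<rightarrow>\<^sub>E {0..<int p}" and D: "symplectic_frame G w' p g t' d"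
      unfolding power_vectors_def by blast
    interpret D: symplectic_frame G w' p g t' d by (rule D)
    have "int p dvd d i" if "i < 2 * g" for i
      using D.t_pow_p[OF that] exp[OF D.t_closed[OF that]] D.w_pow_eq_one_iff[of "d i"] by simp
    then show "d \<in> {\<lambda>i\<in>{..<2 * g}. 0}" using eq_zero_vector[OF d] by simp
  qed
  interpret F: symplectic_frame G w p g t c by (rule F)
  have "t i [^] p = w [^] ((\<lambda>i\<in>{..<2 * g}. 0) i :: int)" if "i < 2 * g" for i
    using that exp[OF F.t_closed[OF that]] by simp
  then have "symplectic_frame G w p g t (\<lambda>i\<in>{..<2 * g}. 0)"
    by unfold_locales (simp_all only: F.t_closed F.t_comm_exp F.order_G)
  then show "{\<lambda>i\<in>{..<2 * g}. 0} \<subseteq> power_vectors"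
    using zero_vector unfolding power_vectors_def by blast
qed

text \<open>
  The zero vector would make the \<open>p\<close>-th power map trivial on all of \<open>G\<close>. Every nonzero vector arises
  from the given frame by transvections.
\<close>

lemma card_power_vectors_exponent_p2:
  assumes x: "x \<in> carrier G" "x [^] p \<noteq> \<one>" and F: "symplectic_frame G w p g t c"
  shows "card power_vectors = p ^ (2 * g) - 1"
proof -
  have nonzero: "\<exists>i<2 * g. \<not> int p dvd c' i" if D: "symplectic_frame G w' p g t' c'" for w' t' c'
  proof (rule ccontr)
    assume "\<not> ?thesis"
    then have "x [^] p = \<one>"
      by (intro symplectic_frame.exponent_p[OF D odd_p _ x(1)]) simp
    with x(2) show False by simp
  qed
  have "power_vectors = ({..<2 * g} \<rightarrow>\<^sub>E {0..<int p}) - {\<lambda>i\<in>{..<2 * g}. 0}"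
  proof
    show "power_vectors \<subseteq> ({..<2 * g} \<rightarrow>\<^sub>E {0..<int p}) - {\<lambda>i\<in>{..<2 * g}. 0}"
    proof
      fix d assume "d \<in> power_vectors"
      then obtain w' t' where d: "d \<in> {..<2 * g} \<rightarrow>\<^sub>E {0..<int p}" and D: "symplectic_frame G w' p g t' d"
        unfolding power_vectors_def by blast
      have "d \<noteq> (\<lambda>i\<in>{..<2 * g}. 0)" using nonzero[OF D] by auto
      with d show "d \<in> ({..<2 * g} \<rightarrow>\<^sub>E {0..<int p}) - {\<lambda>i\<in>{..<2 * g}. 0}" by simp
    qed
    show "({..<2 * g} \<rightarrow>\<^sub>E {0..<int p}) - {\<lambda>i\<in>{..<2 * g}. 0} \<subseteq> power_vectors"
    proof
      fix d assume "d \<in> ({..<2 * g} \<rightarrow>\<^sub>E {0..<int p}) - {\<lambda>i\<in>{..<2 * g}. 0}"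
      then have d: "d \<in> {..<2 * g} \<rightarrow>\<^sub>E {0..<int p}" "d \<noteq> (\<lambda>i\<in>{..<2 * g}. 0)" by simp_all
      obtain j where j: "j < 2 * g" "\<not> int p dvd d j"
        using eq_zero_vector[OF d(1)] d(2) by blast
      obtain i where i: "i < 2 * g" "\<not> int p dvd c i" using nonzero[OF F] by blast
      interpret F: symplectic_frame G w p g t c by (rule F)
      obtain t' where "symplectic_frame G w p g t' d"
        by (rule F.exists_frame_with_powers[where d = d, OF odd_p i j])
      then show "d \<in> power_vectors" using d(1) unfolding power_vectors_def by blast
    qed
  qed
  then show ?thesis
    using zero_vector by (simp only: card_Diff_singleton) (simp add: card_PiE)
qed

lemma iso_presented_epi:
  assumes "G \<cong> presented_group S R"
  obtains \<phi> where "\<phi> \<in> epi (presented_group S R) G"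
proof -
  have "presented_group S R \<cong> G" using assms by (rule iso_sym)
  then obtain \<phi> where "\<phi> \<in> iso (presented_group S R) G" by (auto simp: is_iso_def)
  then show thesis by (intro that) (auto simp: iso_iff epi_def)
qed

lemma N_circ_H_group:
  assumes g: "[int g = - 1] (mod int p)" and iso: "G \<cong> H_group p g"
  shows "N_circ g G = 1"
proof -
  define R where "R = es_common_rels p g \<union>
      {(wpow p (gen (EsX i)), []) | i. i \<in> {1..g}} \<union> {(wpow p (gen (EsY i)), []) | i. i \<in> {1..g}}"
  obtain \<phi> where epi: "\<phi> \<in> epi (presented_group (es_gens g) R) G"
    using iso unfolding H_group_def R_def by (rule iso_presented_epi)
  then have hom: "\<phi> \<in> hom (presented_group (es_gens g) R) G" by (simp add: epi_def)
  define f where "f x = \<phi> (word_class (es_gens g) R (gen x))" for x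
  interpret V: group_valuation G "es_gens g" f
    unfolding f_def by (rule presented_hom_word_val(1)[OF group_axioms hom])
  have pow: "f (es_basis g i) [^] p = \<one>" if "i < 2 * g" for i
  proof -
    have "(wpow p (gen (es_basis g i)), []) \<in> R"
      using that by (auto simp: R_def es_basis_def)
    then have "word_val G f (wpow p (gen (es_basis g i))) = word_val G f []"
      unfolding f_def using es_basis_in_gens[OF that]
      by (intro presented_hom_word_val(3)[OF group_axioms hom]) simp_all
    then show ?thesis using es_basis_in_gens[OF that] by simp
  qed
  have "es_common_rels p g \<subseteq> R" by (auto simp: R_def)
  from presentation_frame(2)[OF epi this]
  obtain c where F: "symplectic_frame G (inv f EsZ) p g (\<lambda>i. f (es_basis g i)) c"
    unfolding f_def by blast
  interpret F: symplectic_frame G "inv f EsZ" p g "\<lambda>i. f (es_basis g i)" c by (rule F)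
  have "int p dvd c i" if "i < 2 * g" for i
    using F.t_pow_p[OF that] pow[OF that] F.w_pow_eq_one_iff[of "c i"] by simp
  then have "x [^] p = \<one>" if "x \<in> carrier G" for x
    using that by (intro F.exponent_p[OF odd_p])
  then have "power_vectors = {\<lambda>i\<in>{..<2 * g}. 0}"
    by (rule power_vectors_exponent_p[OF _ F])
  then show ?thesis
    by (simp add: N_circ_eq_card_power_vectors[OF g])
qed

lemma N_circ_G_group:
  assumes g: "[int g = - 1] (mod int p)" and iso: "G \<cong> G_group p g"
  shows "N_circ g G = p ^ (2 * g) - 1"
proof -
  define R where "R = es_common_rels p g \<union>
      {(wpow p (gen (EsX i)), []) | i. i \<in> {1..<g}} \<union>
      {(wpow p (gen (EsY i)), []) | i. i \<in> {1..<g}} \<union>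
      {(wpow p (gen (EsX g)), gen EsZ), (wpow p (gen (EsY g)), gen EsZ)}"
  obtain \<phi> where epi: "\<phi> \<in> epi (presented_group (es_gens g) R) G"
    using iso unfolding G_group_def R_def by (rule iso_presented_epi)
  then have hom: "\<phi> \<in> hom (presented_group (es_gens g) R) G" by (simp add: epi_def)
  define f where "f x = \<phi> (word_class (es_gens g) R (gen x))" for x
  interpret V: group_valuation G "es_gens g" f
    unfolding f_def by (rule presented_hom_word_val(1)[OF group_axioms hom])
  have g_gen: "EsX g \<in> es_gens g" using g_pos by simp
  have "word_val G f (wpow p (gen (EsX g))) = word_val G f (gen EsZ)"
    unfolding f_def using g_gen
    by (intro presented_hom_word_val(3)[OF group_axioms hom]) (simp_all add: R_def)
  then have "f (EsX g) [^] p = f EsZ" using g_gen by simp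
  moreover have R: "es_common_rels p g \<subseteq> R" by (auto simp: R_def)
  then have "f EsZ \<noteq> \<one>"
    unfolding f_def by (rule presentation_frame(1)[OF epi])
  ultimately have "f (EsX g) [^] p \<noteq> \<one>" by simp
  moreover obtain c where "symplectic_frame G (inv f EsZ) p g (\<lambda>i. f (es_basis g i)) c"
    using presentation_frame(2)[OF epi R] unfolding f_def by blast
  ultimately show ?thesis
    unfolding N_circ_eq_card_power_vectors[OF g]
    by (rule card_power_vectors_exponent_p2[OF V.f_closed[OF g_gen]])
qed

end

theorem corollary6p11:
  fixes p g :: nat and G :: "('a, 'b) monoid_scheme"
  assumes "Factorial_Ring.prime p" and "odd p" and "g \<ge> 2"
    and "[int g = - 1] (mod int p)"
    and "extra_special p G" and "order G = p ^ (2 * g + 1)"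
  shows "(G \<cong> H_group p g \<longrightarrow> N_circ g G = 1) \<and>
         (G \<cong> G_group p g \<longrightarrow> N_circ g G = p ^ (2 * g) - 1)"
proof -
  have "group G" using assms(5) by (simp add: extra_special_def)
  then interpret extra_special_group G p g
    using assms by (intro extra_special_group.intro extra_special_group_axioms.intro) auto
  show ?thesis using N_circ_H_group N_circ_G_group assms(4) by blast
qed

end
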